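(* Let $n,m\ge1$ be integers and let $H',H''$ be subgroups of $\mathbb F_n$ and $\mathbb F_m$, respectively. Let $\phi_{n,m}:\mathbb F_{nm}\to\mathbb F_n\times\mathbb F_m$ be the group homomorphism with $\phi_{n,m}(g^{(nm)}_{m(i-1)+j})=(g^{(n)}_i,g^{(m)}_j)$ for $1\le i\le n$, $1\le j\le m$. Define the left action $\tilde\phi_{n,m}$ of $\mathbb F_{nm}$ on the set $X:=\mathbb F_n/H'\times\mathbb F_m/H''$ by $$\tilde\phi_{n,m}(g)(xH',yH''):=(g'xH',g''yH'')\qquad((xH',yH'')\in X,\ g\in\mathbb F_{nm}),$$ where $(g',g''):=\phi_{n,m}(g)$. Let $X=\coprod_\mu X_\mu$ be the orbit decomposition with respect to $\tilde\phi_{n,m}$, and for each $\mu$ choose $H_\mu$ to be a stabilizer subgroup of $\mathbb F_{nm}$ associated with $X_\mu$ (the stabilizer of a point of $X_\mu$). Then $$\lambda_{\mathbb F_n/H'}\otimes_\varphi\lambda_{\mathbb F_m/H''}\;\cong\;\bigoplus_\mu\lambda_{\mathbb F_{nm}/H_\mu}$$ (unitary equivalence of unitary representations of $\mathbb F_{nm}$).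
   Context: $\mathbb F_n$ is the free group of rank $n$ with free generators $g^{(n)}_1,\dots,g^{(n)}_n$. For a discrete group $\Gamma$ and a subgroup $\Gamma_0$, $\Gamma/\Gamma_0$ is the left coset space and the quasi-regular representation $\lambda_{\Gamma/\Gamma_0}$ is the unitary representation of $\Gamma$ on $\ell^2(\Gamma/\Gamma_0)$ given by the natural left action of $\Gamma$ on the standard basis. For unitary representations $\pi$ of $\mathbb F_n$ and $\pi'$ of $\mathbb F_m$, $\pi\otimes_\varphi\pi'$ is the unitary representation of $\mathbb F_{nm}$ defined by $\pi\otimes_\varphi\pi':=(\pi\otimes\pi')\circ\varphi_{n,m}$, where $\varphi_{n,m}:C^*(\mathbb F_{nm})\to C^*(\mathbb F_n)\otimes C^*(\mathbb F_m)$ is the unital $*$-homomorphism of full group C$^*$-algebras (minimal tensor product) with $\varphi_{n,m}(g^{(nm)}_{m(i-1)+j})=g^{(n)}_i\otimes g^{(m)}_j$; that is, $(\pi\otimes_\varphi\pi')(g)=\pi(g')\otimes\pi'(g'')$ with $(g',g'')=\phi_{n,m}(g)$. *)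

theory Defs
  imports
    "HOL-Algebra.Group_Action"
    "HOL-Algebra.Left_Coset"
    "HOL-Algebra.Module"
    "HOL-Library.Poly_Mapping"
    "HOL-Analysis.Infinite_Sum"
begin

section \<open>Free groups\<close>

text \<open>The letter \<open>(i, True)\<close> stands for the \<open>i\<close>-th generator, \<open>(i, False)\<close> for its inverse;
  group elements are the reduced words.\<close>

type_synonym word = "(nat \<times> bool) list"

definition inv_letter :: "nat \<times> bool \<Rightarrow> nat \<times> bool" where
  "inv_letter a = (fst a, \<not> snd a)"

fun reduced :: "word \<Rightarrow> bool" where
  "reduced (a # b # w) \<longleftrightarrow> b \<noteq> inv_letter a \<and> reduced (b # w)"
| "reduced _ \<longleftrightarrow> True"

text \<open>Left multiplication of a reduced word by a letter.\<close>

fun cons_reduced :: "nat \<times> bool \<Rightarrow> word \<Rightarrow> word" where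
  "cons_reduced a [] = [a]"
| "cons_reduced a (b # w) = (if b = inv_letter a then w else a # b # w)"

definition free_group :: "nat \<Rightarrow> word monoid" where
  "free_group n =
     \<lparr>carrier = {w. reduced w \<and> fst ` set w \<subseteq> {1..n}},
      monoid.mult = foldr cons_reduced,
      one = []\<rparr>"

definition gen :: "nat \<Rightarrow> word" where
  "gen i = [(i, True)]"

text \<open>The homomorphism sending the \<open>i\<close>-th generator to \<open>f i\<close>.\<close>

definition free_lift :: "('g, 'c) monoid_scheme \<Rightarrow> (nat \<Rightarrow> 'g) \<Rightarrow> word \<Rightarrow> 'g" where
  "free_lift G f w =
     foldr (\<lambda>a x. (if snd a then f (fst a) else inv\<^bsub>G\<^esub> f (fst a)) \<otimes>\<^bsub>G\<^esub> x) w \<one>\<^bsub>G\<^esub>"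

lemma inv_letter_inv_letter [simp]: "inv_letter (inv_letter a) = a"
  by (simp add: inv_letter_def)

lemma fst_inv_letter [simp]: "fst (inv_letter a) = fst a"
  by (simp add: inv_letter_def)

lemma reduced_Cons: "reduced (a # w) \<longleftrightarrow> reduced w \<and> (w = [] \<or> hd w \<noteq> inv_letter a)"
  by (cases w) auto

lemma reduced_cons_reduced: "reduced w \<Longrightarrow> reduced (cons_reduced a w)"
  by (cases w) (auto simp: reduced_Cons)

lemma cons_reduced_inv: "reduced w \<Longrightarrow> cons_reduced (inv_letter a) (cons_reduced a w) = w"
  by (cases w) (auto simp: reduced_Cons, (metis inv_letter_inv_letter cons_reduced.simps
        hd_Cons_tl)+)

lemma cons_reduced_inv': "reduced w \<Longrightarrow> cons_reduced a (cons_reduced (inv_letter a) w) = w"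
  using cons_reduced_inv[of w "inv_letter a"] by simp

lemma reduced_foldr: "reduced v \<Longrightarrow> reduced (foldr cons_reduced u v)"
  by (induction u) (auto simp: reduced_cons_reduced)

lemma set_cons_reduced: "set (cons_reduced a w) \<subseteq> insert a (set w)"
  by (cases w) auto

lemma set_foldr: "set (foldr cons_reduced u v) \<subseteq> set u \<union> set v"
proof (induction u)
  case (Cons a u)
  then show ?case
    using set_cons_reduced[of a "foldr cons_reduced u v"] by auto
qed simp

lemma foldr_cons_reduced:
  assumes "reduced w"
  shows "foldr cons_reduced (cons_reduced a u) w = cons_reduced a (foldr cons_reduced u w)"
proof (cases u)
  case (Cons b u')
  then show ?thesis
    using cons_reduced_inv'[OF reduced_foldr[OF assms, of u'], of a] by auto
qed simp

lemma foldr_assoc: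
  assumes "reduced w"
  shows "foldr cons_reduced (foldr cons_reduced u v) w
       = foldr cons_reduced u (foldr cons_reduced v w)"
  by (induction u) (auto simp: foldr_cons_reduced[OF assms])

lemma foldr_Nil: "reduced u \<Longrightarrow> foldr cons_reduced u [] = u"
proof (induction u)
  case (Cons a u)
  then show ?case by (cases u) (auto simp: reduced_Cons)
qed simp

lemma foldr_inverse:
  "reduced u \<Longrightarrow> reduced v \<Longrightarrow>
     foldr cons_reduced (map inv_letter (rev u)) (foldr cons_reduced u v) = v"
  by (induction u arbitrary: v) (auto simp: reduced_Cons cons_reduced_inv reduced_foldr)

theorem group_free_group: "group (free_group n)"
proof (rule groupI)
  fix x assume x: "x \<in> carrier (free_group n)"
  let ?y = "foldr cons_reduced (map inv_letter (rev x)) []"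
  have "fst ` set ?y \<subseteq> fst ` (set (map inv_letter (rev x)) \<union> set [])"
    using set_foldr[of "map inv_letter (rev x)" "[]"] by blast
  also have "\<dots> \<subseteq> {1..n}"
    using x by (auto simp: free_group_def)
  finally have "?y \<in> carrier (free_group n)"
    by (simp add: free_group_def reduced_foldr)
  moreover have "foldr cons_reduced ?y x = []"
    using x foldr_inverse[of x "[]"]
    by (auto simp: free_group_def foldr_assoc foldr_Nil)
  ultimately show "\<exists>y\<in>carrier (free_group n). y \<otimes>\<^bsub>free_group n\<^esub> x = \<one>\<^bsub>free_group n\<^esub>"
    by (auto simp: free_group_def)
next
  fix x y assume "x \<in> carrier (free_group n)" "y \<in> carrier (free_group n)"
  then show "x \<otimes>\<^bsub>free_group n\<^esub> y \<in> carrier (free_group n)"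
    using set_foldr[of x y] by (fastforce simp: free_group_def reduced_foldr)
qed (auto simp: free_group_def foldr_assoc)

lemma gen_closed: "i \<in> {1..n} \<Longrightarrow> gen i \<in> carrier (free_group n)"
  by (simp add: gen_def free_group_def)

lemma free_lift_cons_reduced:
  assumes "group G" "f ` fst ` set (a # w) \<subseteq> carrier G"
  shows "free_lift G f (cons_reduced a w) = free_lift G f (a # w)"
    and "free_lift G f w \<in> carrier G"
proof -
  interpret group G by fact
  have closed: "f ` fst ` set v \<subseteq> carrier G \<Longrightarrow> free_lift G f v \<in> carrier G" for v
    by (induction v) (auto simp: free_lift_def)
  then show "free_lift G f w \<in> carrier G"
    using assms(2) by auto
  show "free_lift G f (cons_reduced a w) = free_lift G f (a # w)"
  proof (cases w)
    case (Cons b v)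
    have "free_lift G f v \<in> carrier G" "f (fst a) \<in> carrier G"
      using assms(2) Cons by (auto intro!: closed)
    then show ?thesis
      using Cons by (auto simp: free_lift_def inv_letter_def simp flip: m_assoc)
  qed simp
qed

theorem free_lift_hom:
  assumes "group G" "\<And>i. i \<in> {1..n} \<Longrightarrow> f i \<in> carrier G"
  shows "free_lift G f \<in> hom (free_group n) G"
    and "i \<in> {1..n} \<Longrightarrow> free_lift G f (gen i) = f i"
proof -
  interpret group G by fact
  have *: "f ` fst ` set w \<subseteq> carrier G" if "fst ` set w \<subseteq> {1..n}" for w :: word
    using that assms(2) by blast
  have closed: "free_lift G f w \<in> carrier G" if "f ` fst ` set w \<subseteq> carrier G" for w
    using that by (induction w) (auto simp: free_lift_def)
  have mult: "free_lift G f (foldr cons_reduced u v) = free_lift G f u \<otimes>\<^bsub>G\<^esub> free_lift G f v"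
    if "f ` fst ` set u \<subseteq> carrier G" "f ` fst ` set v \<subseteq> carrier G" for u v
    using that
  proof (induction u)
    case Nil
    then show ?case using closed[of v] by (simp add: free_lift_def)
  next
    case (Cons a u)
    have "f ` fst ` set (a # foldr cons_reduced u v) \<subseteq> carrier G"
      using Cons.prems set_foldr[of u v] by (fastforce simp: image_subset_iff)
    then have "free_lift G f (foldr cons_reduced (a # u) v)
             = free_lift G f (a # foldr cons_reduced u v)"
      using free_lift_cons_reduced(1)[OF assms(1)] by simp
    then show ?case
      using Cons closed[of u] closed[of v] by (auto simp: free_lift_def m_assoc)
  qed
  show "free_lift G f \<in> hom (free_group n) G"
    using * closed mult by (auto simp: hom_def free_group_def)
  show "i \<in> {1..n} \<Longrightarrow> free_lift G f (gen i) = f i"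
    using assms(2) by (auto simp: free_lift_def gen_def)
qed

theorem free_group_hom_unique:
  assumes "group G" "h \<in> hom (free_group n) G" "h' \<in> hom (free_group n) G"
    and "\<And>i. i \<in> {1..n} \<Longrightarrow> h (gen i) = h' (gen i)" "w \<in> carrier (free_group n)"
  shows "h w = h' w"
proof -
  interpret F: group "free_group n" by (rule group_free_group)
  interpret h: group_hom "free_group n" G h
    using assms by (simp add: group_hom_def group_hom_axioms_def group_free_group)
  interpret h': group_hom "free_group n" G h'
    using assms by (simp add: group_hom_def group_hom_axioms_def group_free_group)
  have letter: "h [(i, b)] = h' [(i, b)]" if i: "i \<in> {1..n}" for i b
  proof (cases b)
    case True
    then show ?thesis using assms(4)[OF i] by (simp add: gen_def)
  next
    case False
    have "inv\<^bsub>free_group n\<^esub> gen i = [(i, False)]"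
      by (rule F.inv_equality)
         (use i in \<open>auto simp: gen_def free_group_def inv_letter_def\<close>)
    then show ?thesis
      using assms(4)[OF i] gen_closed[OF i] False h.hom_inv h'.hom_inv by metis
  qed
  show ?thesis
    using assms(5)
  proof (induction w)
    case Nil
    then show ?case
      using h.hom_one h'.hom_one by (simp add: free_group_def)
  next
    case (Cons a w)
    have c: "[a] \<in> carrier (free_group n)" "w \<in> carrier (free_group n)" "fst a \<in> {1..n}"
      using Cons.prems by (auto simp: free_group_def reduced_Cons)
    have "a # w = [a] \<otimes>\<^bsub>free_group n\<^esub> w"
      using Cons.prems by (cases w) (auto simp: free_group_def)
    then show ?case
      using c Cons.IH letter[of "fst a" "snd a"] h.hom_mult h'.hom_mult by simp
  qed
qed

definition phi :: "nat \<Rightarrow> nat \<Rightarrow> word \<Rightarrow> word \<times> word" where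
  "phi n m = free_lift (free_group n \<times>\<times> free_group m)
               (\<lambda>k. (gen ((k - 1) div m + 1), gen ((k - 1) mod m + 1)))"

theorem phi_hom:
  assumes "n \<ge> 1" "m \<ge> 1"
  shows "phi n m \<in> hom (free_group (n * m)) (free_group n \<times>\<times> free_group m)"
    and "i \<in> {1..n} \<Longrightarrow> j \<in> {1..m} \<Longrightarrow> phi n m (gen (m * (i - 1) + j)) = (gen i, gen j)"
proof -
  have G: "group (free_group n \<times>\<times> free_group m)"
    by (intro DirProd_group group_free_group)
  have f: "(gen ((k - 1) div m + 1), gen ((k - 1) mod m + 1))
             \<in> carrier (free_group n \<times>\<times> free_group m)" if "k \<in> {1..n * m}" for k
  proof -
    have "(k - 1) div m < n"
      using that assms by (intro less_mult_imp_div_less) auto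
    then have "(k - 1) div m + 1 \<in> {1..n}" by simp
    moreover have "(k - 1) mod m + 1 \<in> {1..m}"
      using assms mod_less_divisor[of m "k - 1"] by (simp add: Suc_le_eq)
    ultimately show ?thesis by (simp add: gen_closed)
  qed
  show "phi n m \<in> hom (free_group (n * m)) (free_group n \<times>\<times> free_group m)"
    unfolding phi_def by (rule free_lift_hom(1)[OF G f])
  assume ij: "i \<in> {1..n}" "j \<in> {1..m}"
  obtain i' j' where [simp]: "i = Suc i'" "j = Suc j'" and "i' < n" "j' < m"
    using ij by (cases i; cases j) auto
  have "m * i' + Suc j' \<le> m * Suc i'" using \<open>j' < m\<close> by simp
  also have "\<dots> \<le> m * n" using \<open>i' < n\<close> by (intro mult_le_mono) auto
  finally have "m * (i - 1) + j \<in> {1..n * m}" by (simp add: mult.commute)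
  from free_lift_hom(2)[OF G f this]
  show "phi n m (gen (m * (i - 1) + j)) = (gen i, gen j)"
    using \<open>j' < m\<close> by (simp add: phi_def)
qed


section \<open>Complex Hilbert spaces\<close>

definition complex_ring :: "complex ring" where
  "complex_ring = \<lparr>carrier = UNIV, monoid.mult = (*), one = 1, zero = 0, add = (+)\<rparr>"

text \<open>The fields \<open>mult\<close> and \<open>one\<close> that a module record inherits from rings carry no meaning and
  are left \<open>undefined\<close> below. Inner products are linear in the first argument.\<close>

record 'v hilb = "(complex, 'v) module" +
  ip :: "'v \<Rightarrow> 'v \<Rightarrow> complex"

definition hnorm :: "'v hilb \<Rightarrow> 'v \<Rightarrow> real" where
  "hnorm V x = sqrt (Re (ip V x x))"

definition cauchy_seqs :: "'v hilb \<Rightarrow> (nat \<Rightarrow> 'v) set" where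
  "cauchy_seqs V = {u. (\<forall>k. u k \<in> carrier V) \<and>
     (\<forall>e>0. \<exists>N. \<forall>k\<ge>N. \<forall>l\<ge>N. hnorm V (u k \<ominus>\<^bsub>V\<^esub> u l) < e)}"

locale hilbert_space = Module.module complex_ring V for V :: "'v hilb" (structure) +
  assumes ip_add: "\<lbrakk>x \<in> carrier V; y \<in> carrier V; z \<in> carrier V\<rbrakk>
      \<Longrightarrow> ip V (x \<oplus> y) z = ip V x z + ip V y z"
    and ip_smult: "\<lbrakk>x \<in> carrier V; y \<in> carrier V\<rbrakk> \<Longrightarrow> ip V (c \<odot> x) y = c * ip V x y"
    and ip_cnj: "\<lbrakk>x \<in> carrier V; y \<in> carrier V\<rbrakk> \<Longrightarrow> ip V y x = cnj (ip V x y)"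
    and ip_nonneg: "x \<in> carrier V \<Longrightarrow> Re (ip V x x) \<ge> 0"
    and ip_definite: "\<lbrakk>x \<in> carrier V; ip V x x = 0\<rbrakk> \<Longrightarrow> x = \<zero>"
    and complete: "u \<in> cauchy_seqs V
      \<Longrightarrow> \<exists>x\<in>carrier V. (\<lambda>k. hnorm V (u k \<ominus> x)) \<longlonglongrightarrow> 0"

definition unitary_op :: "'v hilb \<Rightarrow> 'w hilb \<Rightarrow> ('v \<Rightarrow> 'w) \<Rightarrow> bool" where
  "unitary_op V W U \<longleftrightarrow>
     bij_betw U (carrier V) (carrier W) \<and>
     (\<forall>x\<in>carrier V. \<forall>y\<in>carrier V. U (x \<oplus>\<^bsub>V\<^esub> y) = U x \<oplus>\<^bsub>W\<^esub> U y) \<and>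
     (\<forall>c. \<forall>x\<in>carrier V. U (c \<odot>\<^bsub>V\<^esub> x) = c \<odot>\<^bsub>W\<^esub> U x) \<and>
     (\<forall>x\<in>carrier V. \<forall>y\<in>carrier V. ip W (U x) (U y) = ip V x y)"

definition ell2 :: "'a set \<Rightarrow> ('a \<Rightarrow> complex) hilb" where
  "ell2 X =
     \<lparr>carrier = {f. (\<forall>x. x \<notin> X \<longrightarrow> f x = 0) \<and> (\<lambda>x. (cmod (f x))\<^sup>2) summable_on X},
      monoid.mult = undefined, one = undefined,
      zero = (\<lambda>x. 0),
      add = (\<lambda>f g x. f x + g x),
      smult = (\<lambda>c f x. c * f x),
      ip = (\<lambda>f g. \<Sum>\<^sub>\<infinity>x\<in>X. f x * cnj (g x))\<rparr>"

definition hilb_sum :: "'i set \<Rightarrow> ('i \<Rightarrow> 'v hilb) \<Rightarrow> ('i \<Rightarrow> 'v) hilb" where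
  "hilb_sum I V =
     \<lparr>carrier = {f \<in> (\<Pi>\<^sub>E i\<in>I. carrier (V i)). (\<lambda>i. (hnorm (V i) (f i))\<^sup>2) summable_on I},
      monoid.mult = undefined, one = undefined,
      zero = (\<lambda>i\<in>I. \<zero>\<^bsub>V i\<^esub>),
      add = (\<lambda>f g. \<lambda>i\<in>I. f i \<oplus>\<^bsub>V i\<^esub> g i),
      smult = (\<lambda>c f. \<lambda>i\<in>I. c \<odot>\<^bsub>V i\<^esub> f i),
      ip = (\<lambda>f g. \<Sum>\<^sub>\<infinity>i\<in>I. ip (V i) (f i) (g i))\<rparr>"

text \<open>The separated completion of a space with a positive semidefinite inner product: Cauchy
  sequences modulo sequences tending to \<open>0\<close> in norm.\<close>

definition null_rel :: "'v hilb \<Rightarrow> ((nat \<Rightarrow> 'v) \<times> (nat \<Rightarrow> 'v)) set" where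
  "null_rel V = {(u, v). u \<in> cauchy_seqs V \<and> v \<in> cauchy_seqs V \<and>
     (\<lambda>k. hnorm V (u k \<ominus>\<^bsub>V\<^esub> v k)) \<longlonglongrightarrow> 0}"

definition completion :: "'v hilb \<Rightarrow> (nat \<Rightarrow> 'v) set hilb" where
  "completion V =
     \<lparr>carrier = cauchy_seqs V // null_rel V,
      monoid.mult = undefined, one = undefined,
      zero = null_rel V `` {\<lambda>k. \<zero>\<^bsub>V\<^esub>},
      add = (\<lambda>C D. \<Union>u\<in>C. \<Union>v\<in>D. null_rel V `` {\<lambda>k. u k \<oplus>\<^bsub>V\<^esub> v k}),
      smult = (\<lambda>c C. \<Union>u\<in>C. null_rel V `` {\<lambda>k. c \<odot>\<^bsub>V\<^esub> u k}),
      ip = (\<lambda>C D. the_elem (\<Union>u\<in>C. \<Union>v\<in>D. {lim (\<lambda>k. ip V (u k) (v k))}))\<rparr>"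

text \<open>The Hilbert space tensor product is the completion of the algebraic one. The latter is the
  quotient of the free vector space on \<open>carrier V \<times> carrier W\<close> (formal finite sums of elementary
  tensors) by the bilinearity relations. These relations span the kernel of the semidefinite inner
  product below, so that the separated completion divides them out.\<close>

definition free_tensor :: "'v hilb \<Rightarrow> 'w hilb \<Rightarrow> ('v \<times> 'w \<Rightarrow>\<^sub>0 complex) hilb" where
  "free_tensor V W =
     \<lparr>carrier = {s. Poly_Mapping.keys s \<subseteq> carrier V \<times> carrier W},
      monoid.mult = undefined, one = undefined,
      zero = 0,
      add = (+),
      smult = (\<lambda>c s. Poly_Mapping.map ((*) c) s),
      ip = (\<lambda>s t. \<Sum>p\<in>Poly_Mapping.keys s. \<Sum>q\<in>Poly_Mapping.keys t.
              Poly_Mapping.lookup s p * cnj (Poly_Mapping.lookup t q) *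
              (ip V (fst p) (fst q) * ip W (snd p) (snd q)))\<rparr>"

definition hilb_tensor :: "'v hilb \<Rightarrow> 'w hilb \<Rightarrow> (nat \<Rightarrow> ('v \<times> 'w \<Rightarrow>\<^sub>0 complex)) set hilb" where
  "hilb_tensor V W = completion (free_tensor V W)"

text \<open>\<open>free_tensor_op A B\<close> maps each formal elementary tensor \<open>x \<otimes> y\<close> to \<open>A x \<otimes> B y\<close>.\<close>

definition free_tensor_op ::
    "('v \<Rightarrow> 'v) \<Rightarrow> ('w \<Rightarrow> 'w) \<Rightarrow> ('v \<times> 'w \<Rightarrow>\<^sub>0 complex) \<Rightarrow> ('v \<times> 'w \<Rightarrow>\<^sub>0 complex)" where
  "free_tensor_op A B s =
     (\<Sum>p\<in>Poly_Mapping.keys s. Poly_Mapping.single (map_prod A B p) (Poly_Mapping.lookup s p))"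

definition tensor_op :: "'v hilb \<Rightarrow> 'w hilb \<Rightarrow> ('v \<Rightarrow> 'v) \<Rightarrow> ('w \<Rightarrow> 'w) \<Rightarrow>
    (nat \<Rightarrow> ('v \<times> 'w \<Rightarrow>\<^sub>0 complex)) set \<Rightarrow> (nat \<Rightarrow> ('v \<times> 'w \<Rightarrow>\<^sub>0 complex)) set" where
  "tensor_op V W A B C =
     (\<Union>u\<in>C. null_rel (free_tensor V W) `` {\<lambda>k. free_tensor_op A B (u k)})"


section \<open>Unitary representations\<close>

record ('g, 'v) rep =
  rep_space :: "'v hilb"
  rep_act :: "'g \<Rightarrow> 'v \<Rightarrow> 'v"

definition unitary_rep :: "('g, 'c) monoid_scheme \<Rightarrow> ('g, 'v) rep \<Rightarrow> bool" where
  "unitary_rep G \<rho> \<longleftrightarrow>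
     group G \<and> hilbert_space (rep_space \<rho>) \<and>
     (\<forall>g\<in>carrier G. unitary_op (rep_space \<rho>) (rep_space \<rho>) (rep_act \<rho> g)) \<and>
     (\<forall>g\<in>carrier G. \<forall>h\<in>carrier G. \<forall>x\<in>carrier (rep_space \<rho>).
        rep_act \<rho> (g \<otimes>\<^bsub>G\<^esub> h) x = rep_act \<rho> g (rep_act \<rho> h x))"

definition unitarily_equivalent ::
    "('g, 'c) monoid_scheme \<Rightarrow> ('g, 'v) rep \<Rightarrow> ('g, 'w) rep \<Rightarrow> bool" where
  "unitarily_equivalent G \<rho> \<sigma> \<longleftrightarrow>
     unitary_rep G \<rho> \<and> unitary_rep G \<sigma> \<and>
     (\<exists>U. unitary_op (rep_space \<rho>) (rep_space \<sigma>) U \<and>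
        (\<forall>g\<in>carrier G. \<forall>x\<in>carrier (rep_space \<rho>). U (rep_act \<rho> g x) = rep_act \<sigma> g (U x)))"

definition quasi_regular ::
    "('g, 'c) monoid_scheme \<Rightarrow> 'g set \<Rightarrow> ('g, 'g set \<Rightarrow> complex) rep" where
  "quasi_regular G H =
     \<lparr>rep_space = ell2 (lcosets\<^bsub>G\<^esub> H),
      rep_act = (\<lambda>g f C. if C \<in> lcosets\<^bsub>G\<^esub> H then f (inv\<^bsub>G\<^esub> g <#\<^bsub>G\<^esub> C) else 0)\<rparr>"

lemma quasi_regular_basis:
  assumes "group G" "subgroup H G" "g \<in> carrier G" "C \<in> lcosets\<^bsub>G\<^esub> H"
  shows "rep_act (quasi_regular G H) g (\<lambda>D. of_bool (D = C)) = (\<lambda>D. of_bool (D = g <#\<^bsub>G\<^esub> C))"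
proof
  fix D
  interpret group G by fact
  have sub: "E \<subseteq> carrier G" if "E \<in> lcosets\<^bsub>G\<^esub> H" for E
    using subgroup.lcosets_carrier[OF assms(2,1) that] .
  have gC: "g <#\<^bsub>G\<^esub> C \<in> lcosets\<^bsub>G\<^esub> H"
    using assms(3,4) subgroup.subset[OF assms(2)]
    by (auto simp: LCOSETS_def lcos_m_assoc intro!: bexI[OF _ m_closed])
  have "inv\<^bsub>G\<^esub> g <#\<^bsub>G\<^esub> D = C \<longleftrightarrow> D = g <#\<^bsub>G\<^esub> C" if "D \<in> lcosets\<^bsub>G\<^esub> H"
    using assms(3) sub[OF that] sub[OF assms(4)]
    by (auto simp: lcos_m_assoc lcos_mult_one)
  then show "rep_act (quasi_regular G H) g (\<lambda>D. of_bool (D = C)) D = of_bool (D = g <#\<^bsub>G\<^esub> C)"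
    using gC by (auto simp: quasi_regular_def)
qed

definition rep_sum :: "'i set \<Rightarrow> ('i \<Rightarrow> ('g, 'v) rep) \<Rightarrow> ('g, 'i \<Rightarrow> 'v) rep" where
  "rep_sum I \<rho> =
     \<lparr>rep_space = hilb_sum I (\<lambda>i. rep_space (\<rho> i)),
      rep_act = (\<lambda>g f. \<lambda>i\<in>I. rep_act (\<rho> i) g (f i))\<rparr>"

definition rep_tensor :: "('g, 'v) rep \<Rightarrow> ('h, 'w) rep \<Rightarrow>
    ('g \<times> 'h, (nat \<Rightarrow> ('v \<times> 'w \<Rightarrow>\<^sub>0 complex)) set) rep" where
  "rep_tensor \<rho> \<sigma> =
     \<lparr>rep_space = hilb_tensor (rep_space \<rho>) (rep_space \<sigma>),
      rep_act = (\<lambda>(g, h). tensor_op (rep_space \<rho>) (rep_space \<sigma>) (rep_act \<rho> g) (rep_act \<sigma> h))\<rparr>"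

definition tensor_phi :: "nat \<Rightarrow> nat \<Rightarrow> (word, 'v) rep \<Rightarrow> (word, 'w) rep \<Rightarrow>
    (word, (nat \<Rightarrow> ('v \<times> 'w \<Rightarrow>\<^sub>0 complex)) set) rep" where
  "tensor_phi n m \<rho> \<sigma> =
     \<lparr>rep_space = rep_space (rep_tensor \<rho> \<sigma>),
      rep_act = (\<lambda>g. rep_act (rep_tensor \<rho> \<sigma>) (phi n m g))\<rparr>"


section \<open>The action on pairs of cosets\<close>

definition coset_pairs :: "nat \<Rightarrow> nat \<Rightarrow> word set \<Rightarrow> word set \<Rightarrow> (word set \<times> word set) set" where
  "coset_pairs n m H' H'' = (lcosets\<^bsub>free_group n\<^esub> H') \<times> (lcosets\<^bsub>free_group m\<^esub> H'')"

text \<open>Extensional outside of \<^const>\<open>coset_pairs\<close>, as \<^const>\<open>group_action\<close> requires.\<close>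

definition phi_action :: "nat \<Rightarrow> nat \<Rightarrow> word set \<Rightarrow> word set \<Rightarrow> word \<Rightarrow>
    word set \<times> word set \<Rightarrow> word set \<times> word set" where
  "phi_action n m H' H'' g =
     (\<lambda>(C, D)\<in>coset_pairs n m H' H''.
        (fst (phi n m g) <#\<^bsub>free_group n\<^esub> C, snd (phi n m g) <#\<^bsub>free_group m\<^esub> D))"

end

theory Submission
  imports Defs
begin

text \<open>The free group of rank \<open>nm\<close> acts on \<open>X\<close>, hence by permutation of coordinates on \<open>l\<^sup>2(X)\<close>, and both
  representations are identified with this one. Evaluating elementary tensors as functions on
  \<open>X\<close> is an isometry with dense range, so it identifies \<open>l\<^sup>2(X)\<close> with the tensor product
  of the two \<open>l\<^sup>2\<close> spaces; cutting a function on \<open>X\<close> into its restrictions to the orbits and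
  parametrizing each orbit by the cosets of a stabilizer identifies \<open>l\<^sup>2(X)\<close> with the direct sum. That
  the two constructed spaces are Hilbert spaces at all is transported along these unitaries from the
  completeness of \<open>l\<^sup>2(X)\<close>.\<close>

section \<open>Hilbert spaces\<close>

text \<open>The carriers to be compared are of different kinds: sets of Cauchy sequences of formal
  sums on one side, extensional families of functions on the other. Moreover,
  \<open>unitarily_equivalent\<close> includes that both sides are unitary representations, so the
  Hilbert space axioms are part of the claim. Hence both unitaries start at the functions on pairs
  of cosets, and structure and action are pushed forward along them. The operations of
  \<open>completion\<close> are unions over all representatives. Once a class is described as the
  set of all Cauchy sequences whose evaluations tend to a given function \<open>w\<close>, the
  outcome depends on \<open>w\<close> alone, and independence of representatives comes for free. The
  bilinearity relations are absorbed in the same way, since evaluation sends them to 0. On the group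
  side, \<open>phi n m\<close> is a homomorphism, so the pairs of cosets form one set with an
  action. Translating both factors of an elementary tensor is then the same as moving points of that
  set.\<close>

lemma complex_ring_simps [simp]:
  "carrier complex_ring = UNIV" "monoid.mult complex_ring = (*)" "add complex_ring = (+)"
  "one complex_ring = 1" "zero complex_ring = 0"
  by (simp_all add: complex_ring_def)

lemma cring_complex_ring: "cring complex_ring"
proof (rule cringI)
  show "abelian_group complex_ring"
    by (rule abelian_groupI) (auto intro: exI[of _ "- x" for x])
  show "Group.comm_monoid complex_ring"
    by (rule comm_monoidI) (auto simp: mult.assoc mult.commute)
qed (auto simp: algebra_simps)

lemma complex_moduleI:
  fixes M (structure)
  assumes "abelian_group M"
    and "\<And>a x. x \<in> carrier M \<Longrightarrow> a \<odot> x \<in> carrier M"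
    and "\<And>a b x. x \<in> carrier M \<Longrightarrow> (a + b) \<odot> x = (a \<odot> x) \<oplus> (b \<odot> x)"
    and "\<And>a x y. \<lbrakk>x \<in> carrier M; y \<in> carrier M\<rbrakk> \<Longrightarrow> a \<odot> (x \<oplus> y) = (a \<odot> x) \<oplus> (a \<odot> y)"
    and "\<And>a b x. x \<in> carrier M \<Longrightarrow> (a * b) \<odot> x = a \<odot> (b \<odot> x)"
    and "\<And>x. x \<in> carrier M \<Longrightarrow> 1 \<odot> x = x"
  shows "Module.module complex_ring M"
  using assms by (intro moduleI cring_complex_ring) simp_all

text \<open>Adding \<open>J y\<close> to either side gives \<open>J x\<close>. Additivity on
  carriers is all that is asked, so that one statement serves a transporting unitary, the isometry
  \<open>J\<close> of the completion and a unitary on its target.\<close>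

lemma additive_minus:
  assumes "abelian_group V" "abelian_group W"
    and "\<And>x. x \<in> carrier V \<Longrightarrow> J x \<in> carrier W"
    and "\<And>x y. \<lbrakk>x \<in> carrier V; y \<in> carrier V\<rbrakk> \<Longrightarrow> J (x \<oplus>\<^bsub>V\<^esub> y) = J x \<oplus>\<^bsub>W\<^esub> J y"
    and "x \<in> carrier V" "y \<in> carrier V"
  shows "J (x \<ominus>\<^bsub>V\<^esub> y) = J x \<ominus>\<^bsub>W\<^esub> J y"
proof -
  interpret V: abelian_group V by fact
  interpret W: abelian_group W by fact
  have "J (x \<ominus>\<^bsub>V\<^esub> y) \<oplus>\<^bsub>W\<^esub> J y = J x"
    using assms(5,6) by (simp flip: assms(4) add: V.minus_eq V.a_assoc V.l_neg)
  then show ?thesis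
    using assms(3,5,6)
    by (metis V.minus_closed W.a_assoc W.a_inv_closed W.minus_eq W.r_neg W.r_zero)
qed

lemma unitary_opD:
  assumes "unitary_op V W U"
  shows "bij_betw U (carrier V) (carrier W)"
    and "x \<in> carrier V \<Longrightarrow> U x \<in> carrier W"
    and "\<lbrakk>x \<in> carrier V; y \<in> carrier V\<rbrakk> \<Longrightarrow> U (x \<oplus>\<^bsub>V\<^esub> y) = U x \<oplus>\<^bsub>W\<^esub> U y"
    and "x \<in> carrier V \<Longrightarrow> U (c \<odot>\<^bsub>V\<^esub> x) = c \<odot>\<^bsub>W\<^esub> U x"
    and "\<lbrakk>x \<in> carrier V; y \<in> carrier V\<rbrakk> \<Longrightarrow> ip W (U x) (U y) = ip V x y"
  using assms by (auto simp: unitary_op_def bij_betw_apply)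

text \<open>Since \<open>V\<close> is not assumed to be a Hilbert space, \<^const>\<open>unitary_op\<close> alone does not determine
  its zero.\<close>

lemma hilbert_space_transport:
  assumes W: "hilbert_space W" and U: "unitary_op W V U" and zero: "U \<zero>\<^bsub>W\<^esub> = \<zero>\<^bsub>V\<^esub>"
  shows "hilbert_space V"
proof -
  interpret W: hilbert_space W by fact
  note U' = unitary_opD(2-5)[OF U]
  \<comment> \<open>Surjectivity of \<open>U\<close> lets every axiom of \<open>V\<close> be tested
    on images; additivity and homogeneity, read from right to left, move each expression inside
    \<open>U\<close>, where the axiom of \<open>W\<close> applies.\<close>
  have ex: "\<exists>w\<in>carrier W. x = U w" if "x \<in> carrier V" for x
    using that unitary_opD(1)[OF U] by (auto simp: bij_betw_def)
  have ab: "abelian_group V"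
  proof (rule abelian_groupI)
    show "\<zero>\<^bsub>V\<^esub> \<in> carrier V" using U'(1)[OF W.M.zero_closed] zero by simp
  next
    fix x assume "x \<in> carrier V"
    then obtain w where w: "w \<in> carrier W" "x = U w" using ex by blast
    show "\<zero>\<^bsub>V\<^esub> \<oplus>\<^bsub>V\<^esub> x = x"
      using w U'(2)[OF W.M.zero_closed w(1)] zero by simp
    show "\<exists>y\<in>carrier V. y \<oplus>\<^bsub>V\<^esub> x = \<zero>\<^bsub>V\<^esub>"
      using w U'(1)[of "\<ominus>\<^bsub>W\<^esub> w"] U'(2)[of "\<ominus>\<^bsub>W\<^esub> w" w] zero
      by (auto simp: W.M.l_neg)
  next
    fix x y z assume "x \<in> carrier V" "y \<in> carrier V" "z \<in> carrier V"
    then obtain a b c where "a \<in> carrier W" "x = U a" "b \<in> carrier W" "y = U b"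
        "c \<in> carrier W" "z = U c" using ex by metis
    then show "x \<oplus>\<^bsub>V\<^esub> y \<oplus>\<^bsub>V\<^esub> z = x \<oplus>\<^bsub>V\<^esub> (y \<oplus>\<^bsub>V\<^esub> z)"
      by (simp flip: U'(2) add: W.M.a_assoc)
  next
    fix x y assume "x \<in> carrier V" "y \<in> carrier V"
    then obtain a b where "a \<in> carrier W" "x = U a" "b \<in> carrier W" "y = U b"
      using ex by metis
    then show "x \<oplus>\<^bsub>V\<^esub> y \<in> carrier V" "x \<oplus>\<^bsub>V\<^esub> y = y \<oplus>\<^bsub>V\<^esub> x"
      by (simp_all flip: U'(2) add: W.M.a_comm U'(1))
  qed
  interpret V: abelian_group V by fact
  have minus: "U (a \<ominus>\<^bsub>W\<^esub> b) = U a \<ominus>\<^bsub>V\<^esub> U b" if "a \<in> carrier W" "b \<in> carrier W" for a b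
    using that by (intro additive_minus[of W V U] ab W.M.abelian_group_axioms U'(1,2))
  have norm: "hnorm V (U a \<ominus>\<^bsub>V\<^esub> U b) = hnorm W (a \<ominus>\<^bsub>W\<^esub> b)"
    if "a \<in> carrier W" "b \<in> carrier W" for a b
    using that by (simp flip: minus add: hnorm_def U'(4))
  have mod: "Module.module complex_ring V"
  proof (rule complex_moduleI[OF ab])
    fix a b :: complex and x assume "x \<in> carrier V"
    then obtain w where w: "w \<in> carrier W" "x = U w" using ex by blast
    then show "a \<odot>\<^bsub>V\<^esub> x \<in> carrier V"
      "(a + b) \<odot>\<^bsub>V\<^esub> x = a \<odot>\<^bsub>V\<^esub> x \<oplus>\<^bsub>V\<^esub> b \<odot>\<^bsub>V\<^esub> x"
      "(a * b) \<odot>\<^bsub>V\<^esub> x = a \<odot>\<^bsub>V\<^esub> (b \<odot>\<^bsub>V\<^esub> x)" "1 \<odot>\<^bsub>V\<^esub> x = x"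
      using W.smult_closed[of _ w] W.smult_l_distr[of a b w] W.smult_assoc1[of a b w]
        W.smult_one[of w]
      by (simp_all flip: U'(2,3) add: U'(1))
  next
    fix a :: complex and x y assume "x \<in> carrier V" "y \<in> carrier V"
    then obtain v w where "w \<in> carrier W" "x = U w" "v \<in> carrier W" "y = U v"
      using ex by metis
    then show "a \<odot>\<^bsub>V\<^esub> (x \<oplus>\<^bsub>V\<^esub> y) = a \<odot>\<^bsub>V\<^esub> x \<oplus>\<^bsub>V\<^esub> a \<odot>\<^bsub>V\<^esub> y"
      using W.smult_r_distr[of a w v] W.smult_closed[of a] by (simp flip: U'(2,3))
  qed
  show ?thesis
  proof (rule hilbert_space.intro[OF mod], unfold_locales)
    fix x y z assume "x \<in> carrier V" "y \<in> carrier V" "z \<in> carrier V"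
    then obtain a b c where "a \<in> carrier W" "x = U a" "b \<in> carrier W" "y = U b"
        "c \<in> carrier W" "z = U c" using ex by metis
    then show "ip V (x \<oplus>\<^bsub>V\<^esub> y) z = ip V x z + ip V y z"
      by (simp flip: U'(2) add: U'(4) W.ip_add)
  next
    fix x y and c :: complex assume "x \<in> carrier V" "y \<in> carrier V"
    then obtain a b where ab: "a \<in> carrier W" "x = U a" "b \<in> carrier W" "y = U b"
      using ex by metis
    then show "ip V (c \<odot>\<^bsub>V\<^esub> x) y = c * ip V x y"
      using W.smult_closed[of c a] by (simp flip: U'(3) add: U'(4) W.ip_smult)
    show "ip V y x = cnj (ip V x y)"
      using ab W.ip_cnj[of a b] by (simp add: U'(4))
  next
    fix x assume "x \<in> carrier V"
    then obtain a where a: "a \<in> carrier W" "x = U a"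
      using ex by metis
    then show "0 \<le> Re (ip V x x)" by (simp add: U'(4) W.ip_nonneg)
    assume "ip V x x = 0"
    then show "x = \<zero>\<^bsub>V\<^esub>" using a W.ip_definite[of a] zero by (simp add: U'(4))
  next
    fix u assume u: "u \<in> cauchy_seqs V"
    \<comment> \<open>The sequence is lifted to \<open>W\<close> term by term. By
      \<open>norm\<close> distances agree, so the lift is Cauchy, and \<open>U\<close> of its limit
      is the limit sought.\<close>
    define w where "w k = (SOME a. a \<in> carrier W \<and> u k = U a)" for k
    have w: "w k \<in> carrier W" "u k = U (w k)" for k
    proof -
      have "\<exists>a. a \<in> carrier W \<and> u k = U a" using u ex[of "u k"] by (auto simp: cauchy_seqs_def)
      from someI_ex[OF this] show "w k \<in> carrier W" "u k = U (w k)"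
        by (simp_all add: w_def)
    qed
    have "w \<in> cauchy_seqs W"
      using u norm[OF w(1) w(1)] by (simp add: cauchy_seqs_def w)
    then obtain a where a: "a \<in> carrier W" "(\<lambda>k. hnorm W (w k \<ominus>\<^bsub>W\<^esub> a)) \<longlonglongrightarrow> 0"
      using W.complete by blast
    show "\<exists>x\<in>carrier V. (\<lambda>k. hnorm V (u k \<ominus>\<^bsub>V\<^esub> x)) \<longlonglongrightarrow> 0"
      by (rule bexI[of _ "U a"]) (simp_all add: a U'(1) w(2) norm[OF w(1) a(1)])
  qed
qed

text \<open>Uniqueness of preimages turns each property of the inverse into the one of
  \<open>U\<close>. The Hilbert space hypothesis makes \<open>carrier V\<close> closed under the
  operations, so that sums and multiples of preimages are again candidates.\<close>

lemma unitary_op_inv: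
  assumes "hilbert_space V" "unitary_op V W U"
  shows "unitary_op W V (inv_into (carrier V) U)"
proof -
  interpret V: hilbert_space V by fact
  let ?I = "inv_into (carrier V) U"
  note U = unitary_opD[OF assms(2)]
  have I: "?I y \<in> carrier V" "U (?I y) = y" if "y \<in> carrier W" for y
    using that U(1) by (auto simp: bij_betw_def inv_into_into f_inv_into_f)
  have eq: "?I y = x" if "x \<in> carrier V" "U x = y" for x y
    using that U(1) by (auto simp: bij_betw_def)
  show ?thesis
    unfolding unitary_op_def
    using bij_betw_inv_into[OF U(1)] V.smult_closed
    by (auto intro!: eq simp: U(3-5) I, metis I U(5))
qed

lemma unitary_op_comp:
  assumes "unitary_op V W U" "unitary_op W X T"
  shows "unitary_op V X (T \<circ> U)"
  using unitary_opD[OF assms(1)] unitary_opD[OF assms(2)]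
  by (auto simp: unitary_op_def intro!: bij_betw_trans[of U])

section \<open>Norm geometry of an abstract Hilbert space\<close>

context hilbert_space
begin

lemma smult_carrier: "x \<in> carrier V \<Longrightarrow> c \<odot> x \<in> carrier V"
  by (rule smult_closed) simp_all

lemma ip_zero_left: "y \<in> carrier V \<Longrightarrow> ip V \<zero> y = 0"
  using ip_smult[of \<zero> y 0] smult_l_null[of \<zero>] by simp

lemma ip_add_right:
  "\<lbrakk>x \<in> carrier V; y \<in> carrier V; z \<in> carrier V\<rbrakk> \<Longrightarrow> ip V z (x \<oplus> y) = ip V z x + ip V z y"
  by (metis M.a_closed complex_cnj_add ip_add ip_cnj)

lemma ip_smult_right:
  "\<lbrakk>x \<in> carrier V; y \<in> carrier V\<rbrakk> \<Longrightarrow> ip V x (c \<odot> y) = cnj c * ip V x y"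
  by (metis complex_cnj_mult ip_cnj ip_smult smult_carrier)

lemma hnorm_nonneg: "x \<in> carrier V \<Longrightarrow> hnorm V x \<ge> 0"
  by (simp add: hnorm_def ip_nonneg)

lemma hnorm_square: "x \<in> carrier V \<Longrightarrow> (hnorm V x)\<^sup>2 = Re (ip V x x)"
  by (simp add: hnorm_def ip_nonneg)

lemma ip_self: "x \<in> carrier V \<Longrightarrow> ip V x x = of_real ((hnorm V x)\<^sup>2)"
  using ip_cnj[of x x] by (simp add: hnorm_square complex_eq_iff)

text \<open>Written as a scalar multiple, the additive inverse of the record falls under the
  linearity rules for \<open>ip\<close> and \<open>hnorm\<close>.\<close>

lemma minus_smult: "\<lbrakk>x \<in> carrier V; y \<in> carrier V\<rbrakk> \<Longrightarrow> x \<ominus> y = x \<oplus> (- 1) \<odot> y"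
proof -
  assume *: "x \<in> carrier V" "y \<in> carrier V"
  have "(- 1) \<odot> y \<oplus> y = \<zero>"
    using smult_l_distr[of "-1" 1 y] smult_one[OF *(2)] smult_l_null[OF *(2)] *(2) by simp
  then have "\<ominus> y = (- 1) \<odot> y"
    using *(2) by (intro M.minus_equality smult_carrier)
  then show ?thesis by (simp add: M.minus_eq)
qed

lemma cauchy_schwarz:
  assumes "x \<in> carrier V" "y \<in> carrier V"
  shows "cmod (ip V x y) \<le> hnorm V x * hnorm V y"
proof (cases "hnorm V y = 0")
  case True
  then have "y = \<zero>" using ip_self[OF assms(2)] ip_definite[OF assms(2)] by simp
  then have "ip V x y = 0"
    using ip_cnj[OF assms(2,1)] ip_zero_left[OF assms(1)] by simp
  then show ?thesis using hnorm_nonneg[OF assms(1)] hnorm_nonneg[OF assms(2)] by simp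
next
  case False
  define q where "q = (hnorm V y)\<^sup>2"
  have q: "q > 0" using False by (simp add: q_def)
  \<comment> \<open>The coefficient that makes \<open>x \<oplus> c \<odot> y\<close> orthogonal to
    \<open>y\<close>; nonnegativity of the squared norm of this vector is the inequality.\<close>
  define c where "c = - ip V x y / of_real q"
  have yy: "ip V y y = of_real q" using ip_self[OF assms(2)] by (simp add: q_def)
  have yx: "ip V y x = cnj (ip V x y)" using ip_cnj assms by blast
  have "ip V (x \<oplus> c \<odot> y) (x \<oplus> c \<odot> y)
      = ip V x x + cnj c * ip V x y + c * cnj (ip V x y) + c * cnj c * of_real q"
    using assms by (simp add: ip_add ip_add_right ip_smult ip_smult_right smult_carrier yy yx
        algebra_simps)
  also have "\<dots> = ip V x x - of_real ((cmod (ip V x y))\<^sup>2 / q)"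
    using q by (simp add: c_def field_simps complex_norm_square[symmetric])
  finally have "(cmod (ip V x y))\<^sup>2 / q \<le> (hnorm V x)\<^sup>2"
    using ip_nonneg[of "x \<oplus> c \<odot> y"] assms by (simp add: smult_carrier hnorm_square)
  then have "(cmod (ip V x y))\<^sup>2 \<le> (hnorm V x * hnorm V y)\<^sup>2"
    using q by (simp add: field_simps power_mult_distrib q_def)
  then show ?thesis
    by (rule power2_le_imp_le) (use assms hnorm_nonneg in auto)
qed

lemma hnorm_triangle:
  assumes "x \<in> carrier V" "y \<in> carrier V"
  shows "hnorm V (x \<oplus> y) \<le> hnorm V x + hnorm V y"
proof (rule power2_le_imp_le)
  have "(hnorm V (x \<oplus> y))\<^sup>2 = (hnorm V x)\<^sup>2 + (hnorm V y)\<^sup>2 + 2 * Re (ip V x y)"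
    using assms ip_cnj[OF assms] by (simp add: hnorm_square ip_add ip_add_right)
  also have "Re (ip V x y) \<le> hnorm V x * hnorm V y"
    using cauchy_schwarz[OF assms] complex_Re_le_cmod order_trans by blast
  finally show "(hnorm V (x \<oplus> y))\<^sup>2 \<le> (hnorm V x + hnorm V y)\<^sup>2"
    by (simp add: power2_sum)
qed (use assms hnorm_nonneg in auto)

lemma hnorm_smult:
  assumes x: "x \<in> carrier V"
  shows "hnorm V (c \<odot> x) = cmod c * hnorm V x"
proof (rule power2_eq_imp_eq)
  have "ip V (c \<odot> x) (c \<odot> x) = (c * cnj c) * ip V x x"
    using x by (simp add: ip_smult ip_smult_right smult_carrier)
  also have "\<dots> = of_real ((cmod c)\<^sup>2 * (hnorm V x)\<^sup>2)"
    by (simp only: ip_self[OF x] complex_norm_square[symmetric] of_real_mult)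
  finally show "(hnorm V (c \<odot> x))\<^sup>2 = (cmod c * hnorm V x)\<^sup>2"
    using x by (simp add: hnorm_square[of "c \<odot> x"] smult_carrier power_mult_distrib)
qed (use x in \<open>auto simp: hnorm_nonneg smult_carrier\<close>)

lemma hnorm_eq_0: "x \<in> carrier V \<Longrightarrow> hnorm V x = 0 \<longleftrightarrow> x = \<zero>"
  using ip_self[of x] ip_definite[of x] ip_zero_left[of \<zero>]
  by (auto simp: hnorm_def)

lemma minus_commute_norm:
  assumes "x \<in> carrier V" "y \<in> carrier V"
  shows "hnorm V (x \<ominus> y) = hnorm V (y \<ominus> x)"
proof -
  have "y \<ominus> x = (- 1) \<odot> (x \<ominus> y)"
    using assms smult_r_distr[of "-1" x "(-1) \<odot> y"] smult_assoc1[of "-1" "-1" y] smult_one[of y]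
    by (simp add: minus_smult smult_carrier M.a_comm)
  then show ?thesis using assms hnorm_smult[of "x \<ominus> y" "-1"] by simp
qed

lemma minus_triangle:
  assumes "x \<in> carrier V" "y \<in> carrier V" "z \<in> carrier V"
  shows "hnorm V (x \<ominus> z) \<le> hnorm V (x \<ominus> y) + hnorm V (y \<ominus> z)"
proof -
  have "x \<ominus> z = (x \<ominus> y) \<oplus> (y \<ominus> z)"
    using assms by (simp add: M.minus_eq M.a_assoc M.r_neg1)
  then show ?thesis using assms hnorm_triangle by simp
qed

lemma add_minus_add:
  assumes "x \<in> carrier V" "y \<in> carrier V" "x' \<in> carrier V" "y' \<in> carrier V"
  shows "(x \<oplus> y) \<ominus> (x' \<oplus> y') = (x \<ominus> x') \<oplus> (y \<ominus> y')"
  using assms by (simp add: M.minus_eq M.minus_add M.a_ac)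

lemma smult_minus:
  assumes "x \<in> carrier V" "y \<in> carrier V"
  shows "c \<odot> x \<ominus> c \<odot> y = c \<odot> (x \<ominus> y)"
  using assms smult_r_distr[of c x "(- 1) \<odot> y"] smult_assoc1[of c "- 1" y]
    smult_assoc1[of "- 1" c y]
  by (simp add: minus_smult smult_carrier)

lemma minus_eq_zero:
  assumes "x \<in> carrier V" "y \<in> carrier V"
  shows "x \<ominus> y = \<zero> \<longleftrightarrow> x = y"
proof
  assume "x \<ominus> y = \<zero>"
  then have "(x \<ominus> y) \<oplus> y = y" using assms by simp
  then show "x = y" using assms by (simp add: M.minus_eq M.a_assoc M.l_neg)
qed (use assms in \<open>simp add: M.minus_eq M.r_neg\<close>)

lemma ip_minus_left:
  "\<lbrakk>x \<in> carrier V; y \<in> carrier V; z \<in> carrier V\<rbrakk> \<Longrightarrow> ip V (x \<ominus> y) z = ip V x z - ip V y z"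
  by (simp add: minus_smult ip_add ip_smult smult_carrier)

lemma ip_minus_right:
  "\<lbrakk>x \<in> carrier V; y \<in> carrier V; z \<in> carrier V\<rbrakk> \<Longrightarrow> ip V z (x \<ominus> y) = ip V z x - ip V z y"
  by (simp add: minus_smult ip_add_right ip_smult_right smult_carrier)

section \<open>Convergence in norm and continuity of the operations\<close>

lemma cauchy_if_convergent:
  assumes "\<And>k. u k \<in> carrier V" "x \<in> carrier V" "(\<lambda>k. hnorm V (u k \<ominus> x)) \<longlonglongrightarrow> 0"
  shows "u \<in> cauchy_seqs V"
proof -
  have "\<exists>N. \<forall>k\<ge>N. \<forall>l\<ge>N. hnorm V (u k \<ominus> u l) < e" if "e > 0" for e
  proof -
    obtain N where N: "\<And>k. k \<ge> N \<Longrightarrow> \<bar>hnorm V (u k \<ominus> x)\<bar> < e / 2"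
      using LIMSEQ_D[OF assms(3), of "e / 2"] \<open>e > 0\<close> by auto
    have "hnorm V (u k \<ominus> u l) < e" if "k \<ge> N" "l \<ge> N" for k l
      using minus_triangle[OF assms(1)[of k] assms(2) assms(1)[of l]] N[OF that(1)] N[OF that(2)]
        minus_commute_norm[OF assms(2) assms(1)[of l]] by linarith
    then show ?thesis by blast
  qed
  with assms(1) show ?thesis by (simp add: cauchy_seqs_def)
qed

lemma limit_unique:
  assumes "\<And>k. u k \<in> carrier V" "x \<in> carrier V" "y \<in> carrier V"
    and "(\<lambda>k. hnorm V (u k \<ominus> x)) \<longlonglongrightarrow> 0" "(\<lambda>k. hnorm V (u k \<ominus> y)) \<longlonglongrightarrow> 0"
  shows "x = y"
proof -
  have "hnorm V (x \<ominus> y) \<le> hnorm V (u k \<ominus> x) + hnorm V (u k \<ominus> y)" for k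
    using minus_triangle[OF assms(2) assms(1)[of k] assms(3)]
      minus_commute_norm[OF assms(2) assms(1)[of k]] by simp
  then have "hnorm V (x \<ominus> y) \<le> 0"
    using tendsto_add[OF assms(4,5)] by (intro LIMSEQ_le_const) auto
  then show ?thesis
    using hnorm_nonneg[of "x \<ominus> y"] hnorm_eq_0[of "x \<ominus> y"] minus_eq_zero[of x y] assms(2,3)
    by simp
qed

text \<open>Together with \<open>limit_diff\<close>: the sequences tending to \<open>x\<close> form
  one full class modulo null sequences, which is how \<open>null_rel_fiber\<close> recognizes a
  class.\<close>

lemma limit_cong:
  assumes "\<And>k. u k \<in> carrier V" "\<And>k. v k \<in> carrier V" "x \<in> carrier V"
    and "(\<lambda>k. hnorm V (u k \<ominus> v k)) \<longlonglongrightarrow> 0" "(\<lambda>k. hnorm V (u k \<ominus> x)) \<longlonglongrightarrow> 0"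
  shows "(\<lambda>k. hnorm V (v k \<ominus> x)) \<longlonglongrightarrow> 0"
proof (rule tendsto_sandwich[OF _ _ tendsto_const])
  have "hnorm V (v k \<ominus> x) \<le> hnorm V (u k \<ominus> v k) + hnorm V (u k \<ominus> x)" for k
    using minus_triangle[of "v k" "u k" x] minus_commute_norm[of "u k" "v k"] assms(1-3) by simp
  then show "\<forall>\<^sub>F k in sequentially.
      hnorm V (v k \<ominus> x) \<le> hnorm V (u k \<ominus> v k) + hnorm V (u k \<ominus> x)"
    by (intro always_eventually allI)
  show "(\<lambda>k. hnorm V (u k \<ominus> v k) + hnorm V (u k \<ominus> x)) \<longlonglongrightarrow> 0"
    using tendsto_add[OF assms(4,5)] by simp
qed (simp add: assms(1-3) hnorm_nonneg)

lemma limit_diff: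
  assumes "\<And>k. u k \<in> carrier V" "\<And>k. v k \<in> carrier V" "x \<in> carrier V"
    and "(\<lambda>k. hnorm V (u k \<ominus> x)) \<longlonglongrightarrow> 0" "(\<lambda>k. hnorm V (v k \<ominus> x)) \<longlonglongrightarrow> 0"
  shows "(\<lambda>k. hnorm V (u k \<ominus> v k)) \<longlonglongrightarrow> 0"
proof (rule tendsto_sandwich[OF _ _ tendsto_const])
  have "hnorm V (u k \<ominus> v k) \<le> hnorm V (u k \<ominus> x) + hnorm V (v k \<ominus> x)" for k
    using minus_triangle[of "u k" x "v k"] minus_commute_norm[of "v k" x] assms(1-3) by simp
  then show "\<forall>\<^sub>F k in sequentially.
      hnorm V (u k \<ominus> v k) \<le> hnorm V (u k \<ominus> x) + hnorm V (v k \<ominus> x)"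
    by (intro always_eventually allI)
  show "(\<lambda>k. hnorm V (u k \<ominus> x) + hnorm V (v k \<ominus> x)) \<longlonglongrightarrow> 0"
    using tendsto_add[OF assms(4,5)] by simp
qed (simp add: assms(1-3) hnorm_nonneg)

lemma limit_add:
  assumes "\<And>k. u k \<in> carrier V" "\<And>k. v k \<in> carrier V" "x \<in> carrier V" "y \<in> carrier V"
    and "(\<lambda>k. hnorm V (u k \<ominus> x)) \<longlonglongrightarrow> 0" "(\<lambda>k. hnorm V (v k \<ominus> y)) \<longlonglongrightarrow> 0"
  shows "(\<lambda>k. hnorm V ((u k \<oplus> v k) \<ominus> (x \<oplus> y))) \<longlonglongrightarrow> 0"
proof (rule tendsto_sandwich[OF _ _ tendsto_const])
  have "hnorm V ((u k \<oplus> v k) \<ominus> (x \<oplus> y)) \<le> hnorm V (u k \<ominus> x) + hnorm V (v k \<ominus> y)" for k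
    using assms(1-4) hnorm_triangle[of "u k \<ominus> x" "v k \<ominus> y"] by (simp add: add_minus_add)
  then show "\<forall>\<^sub>F k in sequentially.
      hnorm V ((u k \<oplus> v k) \<ominus> (x \<oplus> y)) \<le> hnorm V (u k \<ominus> x) + hnorm V (v k \<ominus> y)"
    by (intro always_eventually allI)
  show "(\<lambda>k. hnorm V (u k \<ominus> x) + hnorm V (v k \<ominus> y)) \<longlonglongrightarrow> 0"
    using tendsto_add[OF assms(5,6)] by simp
qed (simp add: assms(1-4) hnorm_nonneg)

lemma limit_smult:
  assumes "\<And>k. u k \<in> carrier V" "x \<in> carrier V" "(\<lambda>k. hnorm V (u k \<ominus> x)) \<longlonglongrightarrow> 0"
  shows "(\<lambda>k. hnorm V (c \<odot> u k \<ominus> c \<odot> x)) \<longlonglongrightarrow> 0"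
  using tendsto_mult_left[OF assms(3), of "cmod c"] assms(1,2)
  by (simp add: smult_minus hnorm_smult)

lemma limit_ip:
  assumes "\<And>k. u k \<in> carrier V" "\<And>k. v k \<in> carrier V" "x \<in> carrier V" "y \<in> carrier V"
    and "(\<lambda>k. hnorm V (u k \<ominus> x)) \<longlonglongrightarrow> 0" "(\<lambda>k. hnorm V (v k \<ominus> y)) \<longlonglongrightarrow> 0"
  shows "(\<lambda>k. ip V (u k) (v k)) \<longlonglongrightarrow> ip V x y"
proof -
  let ?a = "\<lambda>k. hnorm V (u k \<ominus> x)" and ?b = "\<lambda>k. hnorm V (v k \<ominus> y)"
  have bound: "cmod (ip V (u k) (v k) - ip V x y) \<le> ?a k * ?b k + ?a k * hnorm V y + hnorm V x * ?b k" for k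
  proof -
    \<comment> \<open>Expanding both arguments around their limits leaves only the fixed norms of
      \<open>x\<close> and \<open>y\<close> and the null sequences \<open>?a\<close> and
      \<open>?b\<close> in the bound.\<close>
    have "ip V (u k) (v k) - ip V x y
        = ip V (u k \<ominus> x) (v k \<ominus> y) + ip V (u k \<ominus> x) y + ip V x (v k \<ominus> y)"
      using assms(1-4) by (simp add: ip_minus_left ip_minus_right)
    also have "cmod \<dots> \<le> cmod (ip V (u k \<ominus> x) (v k \<ominus> y)) + cmod (ip V (u k \<ominus> x) y)
        + cmod (ip V x (v k \<ominus> y))"
      by (intro order_trans[OF norm_triangle_ineq] add_mono norm_triangle_ineq order_refl)
    also have "\<dots> \<le> ?a k * ?b k + ?a k * hnorm V y + hnorm V x * ?b k"
      using assms(1-4) by (intro add_mono cauchy_schwarz) auto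
    finally show ?thesis .
  qed
  have "(\<lambda>k. ?a k * ?b k + ?a k * hnorm V y + hnorm V x * ?b k) \<longlonglongrightarrow>
      0 * 0 + 0 * hnorm V y + hnorm V x * 0"
    by (intro tendsto_intros assms(5,6))
  then have lim: "(\<lambda>k. ?a k * ?b k + ?a k * hnorm V y + hnorm V x * ?b k) \<longlonglongrightarrow> 0"
    by simp
  have "(\<lambda>k. cmod (ip V (u k) (v k) - ip V x y)) \<longlonglongrightarrow> 0"
    by (rule tendsto_sandwich[OF _ _ tendsto_const lim]) (auto intro!: always_eventually bound)
  then show ?thesis by (simp add: tendsto_norm_zero_iff LIM_zero_iff)
qed

end


section \<open>Completions\<close>

text \<open>A norm-preserving linear map \<open>J\<close> with dense range in a Hilbert space \<open>W\<close> identifies \<open>W\<close> with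
  the completion of its domain: \<open>w\<close> corresponds to the Cauchy sequences whose images tend to \<open>w\<close>.\<close>

locale dense_isometry = W: hilbert_space W + V: abelian_group V
  for W :: "'w hilb" and V :: "'v hilb" +
  fixes J :: "'v \<Rightarrow> 'w"
  assumes smult_closed: "x \<in> carrier V \<Longrightarrow> c \<odot>\<^bsub>V\<^esub> x \<in> carrier V"
    and J_closed: "x \<in> carrier V \<Longrightarrow> J x \<in> carrier W"
    and J_add: "\<lbrakk>x \<in> carrier V; y \<in> carrier V\<rbrakk> \<Longrightarrow> J (x \<oplus>\<^bsub>V\<^esub> y) = J x \<oplus>\<^bsub>W\<^esub> J y"
    and J_smult: "x \<in> carrier V \<Longrightarrow> J (c \<odot>\<^bsub>V\<^esub> x) = c \<odot>\<^bsub>W\<^esub> J x"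
    and J_ip: "\<lbrakk>x \<in> carrier V; y \<in> carrier V\<rbrakk> \<Longrightarrow> ip W (J x) (J y) = ip V x y"
    and dense: "\<lbrakk>w \<in> carrier W; e > 0\<rbrakk> \<Longrightarrow> \<exists>x\<in>carrier V. hnorm W (J x \<ominus>\<^bsub>W\<^esub> w) < e"
begin

definition fiber :: "'w \<Rightarrow> (nat \<Rightarrow> 'v) set" where
  "fiber w = {u \<in> cauchy_seqs V. (\<lambda>k. hnorm W (J (u k) \<ominus>\<^bsub>W\<^esub> w)) \<longlonglongrightarrow> 0}"

lemma J_norm:
  assumes "x \<in> carrier V" "y \<in> carrier V"
  shows "hnorm V (x \<ominus>\<^bsub>V\<^esub> y) = hnorm W (J x \<ominus>\<^bsub>W\<^esub> J y)"
proof -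
  have "J (x \<ominus>\<^bsub>V\<^esub> y) = J x \<ominus>\<^bsub>W\<^esub> J y"
    using assms by (intro additive_minus[of V W J] V.abelian_group_axioms
        W.M.abelian_group_axioms J_closed J_add)
  then show ?thesis using assms by (simp add: hnorm_def flip: J_ip)
qed

lemma cauchy_iff: "u \<in> cauchy_seqs V \<longleftrightarrow>
    (\<forall>k. u k \<in> carrier V) \<and> (\<lambda>k. J (u k)) \<in> cauchy_seqs W"
  by (auto simp: cauchy_seqs_def J_norm J_closed)

lemma fiberI:
  assumes "\<And>k. u k \<in> carrier V" "w \<in> carrier W" "(\<lambda>k. hnorm W (J (u k) \<ominus>\<^bsub>W\<^esub> w)) \<longlonglongrightarrow> 0"
  shows "u \<in> fiber w"
  unfolding fiber_def using assms W.cauchy_if_convergent[of "\<lambda>k. J (u k)" w] J_closed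
  by (auto simp: cauchy_iff)

lemma fiberD:
  assumes "u \<in> fiber w"
  shows "u k \<in> carrier V" "J (u k) \<in> carrier W" "u \<in> cauchy_seqs V"
    and "(\<lambda>k. hnorm W (J (u k) \<ominus>\<^bsub>W\<^esub> w)) \<longlonglongrightarrow> 0"
  using assms J_closed unfolding fiber_def by (auto simp: cauchy_seqs_def)

text \<open>Density supplies approximants at distance below 1/(k+1). Nonemptiness is also what
  collapses the unions over representatives in \<open>completion\<close>: a constant family over a
  nonempty set has that constant as its union.\<close>

lemma fiber_nonempty:
  assumes w: "w \<in> carrier W"
  shows "fiber w \<noteq> {}"
proof -
  have "\<forall>k. \<exists>x\<in>carrier V. hnorm W (J x \<ominus>\<^bsub>W\<^esub> w) < 1 / real (Suc k)"
    using dense[OF w] by simp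
  then obtain u where u: "\<And>k. u k \<in> carrier V" "\<And>k. hnorm W (J (u k) \<ominus>\<^bsub>W\<^esub> w) < 1 / real (Suc k)"
    by metis
  have "(\<lambda>k. hnorm W (J (u k) \<ominus>\<^bsub>W\<^esub> w)) \<longlonglongrightarrow> 0"
  proof (rule tendsto_sandwich[OF _ _ tendsto_const])
    show "(\<lambda>k. 1 / real (Suc k)) \<longlonglongrightarrow> 0" by (rule LIMSEQ_Suc[OF lim_1_over_n])
    show "\<forall>\<^sub>F k in sequentially. hnorm W (J (u k) \<ominus>\<^bsub>W\<^esub> w) \<le> 1 / real (Suc k)"
      using u(2) by (simp add: less_imp_le)
  qed (use u w J_closed W.hnorm_nonneg in auto)
  then show ?thesis using fiberI[of u w] u w by blast
qed

text \<open>Distances in \<open>V\<close> are distances of images in \<open>W\<close>, where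
  sequences differing by a null sequence have the same limit. So any one member of a fiber generates
  the whole fiber as its class.\<close>

lemma null_rel_fiber:
  assumes u: "u \<in> fiber w" and w: "w \<in> carrier W"
  shows "null_rel V `` {u} = fiber w"
proof -
  have "(\<lambda>k. hnorm V (u k \<ominus>\<^bsub>V\<^esub> v k)) \<longlonglongrightarrow> 0 \<longleftrightarrow> (\<lambda>k. hnorm W (J (v k) \<ominus>\<^bsub>W\<^esub> w)) \<longlonglongrightarrow> 0"
    if v: "v \<in> cauchy_seqs V" for v
  proof -
    have vc: "v k \<in> carrier V" for k using v by (simp add: cauchy_iff)
    have "(\<lambda>k. hnorm V (u k \<ominus>\<^bsub>V\<^esub> v k)) = (\<lambda>k. hnorm W (J (u k) \<ominus>\<^bsub>W\<^esub> J (v k)))"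
      using fiberD(1)[OF u] vc by (simp add: J_norm)
    then show ?thesis
      using W.limit_cong[of "\<lambda>k. J (u k)" "\<lambda>k. J (v k)" w]
        W.limit_diff[of "\<lambda>k. J (u k)" "\<lambda>k. J (v k)" w] J_closed vc fiberD[OF u] w by auto
  qed
  then show ?thesis using fiberD(3)[OF u] by (auto simp: null_rel_def fiber_def)
qed

lemma fiber_unique:
  assumes "u \<in> fiber w" "u \<in> fiber w'" "w \<in> carrier W" "w' \<in> carrier W"
  shows "w = w'"
  using W.limit_unique[of "\<lambda>k. J (u k)" w w'] fiberD[OF assms(1)] fiberD[OF assms(2)] assms(3,4)
  by blast

text \<open>Uniqueness of limits gives injectivity. Completeness of \<open>W\<close> gives
  surjectivity: the images of a Cauchy sequence of \<open>V\<close> have a limit, and the class of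
  the sequence is the fiber over it.\<close>

lemma bij_betw_fiber: "bij_betw fiber (carrier W) (carrier (completion V))"
proof (rule bij_betw_imageI)
  show "inj_on fiber (carrier W)"
    using fiber_unique fiber_nonempty by (intro inj_onI) blast
  show "fiber ` carrier W = carrier (completion V)"
  proof (intro equalityI subsetI)
    fix C assume "C \<in> fiber ` carrier W"
    then obtain w u where "C = fiber w" "w \<in> carrier W" "u \<in> fiber w"
      using fiber_nonempty by blast
    then show "C \<in> carrier (completion V)"
      using null_rel_fiber[of u w] fiberD(3)[of u w] by (auto simp: completion_def quotient_def)
  next
    fix C assume "C \<in> carrier (completion V)"
    then obtain u where u: "u \<in> cauchy_seqs V" "C = null_rel V `` {u}"
      by (auto simp: completion_def quotient_def)
    then obtain w where w: "w \<in> carrier W" "(\<lambda>k. hnorm W (J (u k) \<ominus>\<^bsub>W\<^esub> w)) \<longlonglongrightarrow> 0"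
      using W.complete[of "\<lambda>k. J (u k)"] by (auto simp: cauchy_iff)
    then have "C = fiber w" using u null_rel_fiber[of u w] by (auto simp: fiber_def)
    then show "C \<in> fiber ` carrier W" using w by blast
  qed
qed

lemma completion_unitary: "unitary_op W (completion V) fiber"
proof -
  have "fiber (w \<oplus>\<^bsub>W\<^esub> w') = fiber w \<oplus>\<^bsub>completion V\<^esub> fiber w'"
    if w: "w \<in> carrier W" "w' \<in> carrier W" for w w'
  proof -
    \<comment> \<open>Whatever representatives are picked, the resulting class is the fiber over one
      and the same point, so the union defining the operation has constant terms.\<close>
    have "null_rel V `` {\<lambda>k. u k \<oplus>\<^bsub>V\<^esub> v k} = fiber (w \<oplus>\<^bsub>W\<^esub> w')"
      if "u \<in> fiber w" "v \<in> fiber w'" for u v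
      using W.limit_add[of "\<lambda>k. J (u k)" "\<lambda>k. J (v k)" w w'] fiberD[OF that(1)] fiberD[OF that(2)] w
      by (intro null_rel_fiber fiberI) (auto simp: J_add)
    then show ?thesis
      using fiber_nonempty[OF w(1)] fiber_nonempty[OF w(2)] by (simp add: completion_def)
  qed
  moreover have "fiber (c \<odot>\<^bsub>W\<^esub> w) = c \<odot>\<^bsub>completion V\<^esub> fiber w" if w: "w \<in> carrier W" for c w
  proof -
    have "null_rel V `` {\<lambda>k. c \<odot>\<^bsub>V\<^esub> u k} = fiber (c \<odot>\<^bsub>W\<^esub> w)" if "u \<in> fiber w" for u
      using W.limit_smult[of "\<lambda>k. J (u k)" w c] fiberD[OF that] w
      by (intro null_rel_fiber fiberI) (auto simp: J_smult smult_closed W.smult_carrier)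
    then show ?thesis using fiber_nonempty[OF w] by (simp add: completion_def)
  qed
  moreover have "ip (completion V) (fiber w) (fiber w') = ip W w w'"
    if w: "w \<in> carrier W" "w' \<in> carrier W" for w w'
  proof -
    have "lim (\<lambda>k. ip V (u k) (v k)) = ip W w w'" if "u \<in> fiber w" "v \<in> fiber w'" for u v
      using W.limit_ip[of "\<lambda>k. J (u k)" "\<lambda>k. J (v k)" w w'] fiberD[OF that(1)] fiberD[OF that(2)] w
      by (auto intro!: limI simp flip: J_ip)
    then have "(\<Union>u\<in>fiber w. \<Union>v\<in>fiber w'. {lim (\<lambda>k. ip V (u k) (v k))}) = {ip W w w'}"
      using fiber_nonempty[OF w(1)] fiber_nonempty[OF w(2)] by auto
    then show ?thesis by (simp add: completion_def)
  qed
  ultimately show ?thesis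
    using bij_betw_fiber by (simp add: unitary_op_def)
qed

text \<open>The zero of a record is a field of its own, and \<open>hilbert_space_transport\<close>
  asks for it. \<open>J\<close> maps zero to zero because its value there is unchanged by
  doubling.\<close>

lemma completion_zero: "fiber \<zero>\<^bsub>W\<^esub> = \<zero>\<^bsub>completion V\<^esub>"
proof -
  have "J \<zero>\<^bsub>V\<^esub> = \<zero>\<^bsub>W\<^esub>"
    using J_add[of "\<zero>\<^bsub>V\<^esub>" "\<zero>\<^bsub>V\<^esub>"] J_closed[of "\<zero>\<^bsub>V\<^esub>"]
    by (simp add: W.M.add.l_cancel_one')
  then have "hnorm W (J \<zero>\<^bsub>V\<^esub> \<ominus>\<^bsub>W\<^esub> \<zero>\<^bsub>W\<^esub>) = 0"
    by (simp add: W.minus_eq_zero W.hnorm_eq_0)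
  then have "(\<lambda>k. \<zero>\<^bsub>V\<^esub>) \<in> fiber \<zero>\<^bsub>W\<^esub>" by (intro fiberI) simp_all
  then show ?thesis
    using null_rel_fiber[of "\<lambda>k. \<zero>\<^bsub>V\<^esub>" "\<zero>\<^bsub>W\<^esub>"] by (simp add: completion_def)
qed

text \<open>The left side has the shape of \<open>tensor_op\<close>: apply \<open>T\<close> to all
  terms of all representatives. The images under \<open>J\<close> are moved by the isometry
  \<open>P\<close>, hence tend to \<open>P w\<close>.\<close>

lemma fiber_map:
  assumes P: "unitary_op W W P" and T: "\<And>x. x \<in> carrier V \<Longrightarrow> T x \<in> carrier V"
    and J_T: "\<And>x. x \<in> carrier V \<Longrightarrow> J (T x) = P (J x)" and w: "w \<in> carrier W"
  shows "(\<Union>u\<in>fiber w. null_rel V `` {\<lambda>k. T (u k)}) = fiber (P w)"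
proof -
  note P' = unitary_opD(2-5)[OF P]
  have "P (x \<ominus>\<^bsub>W\<^esub> y) = P x \<ominus>\<^bsub>W\<^esub> P y" if "x \<in> carrier W" "y \<in> carrier W" for x y
    using that by (intro additive_minus[of W W P] W.M.abelian_group_axioms P'(1,2))
  then have norm: "hnorm W (P x \<ominus>\<^bsub>W\<^esub> P y) = hnorm W (x \<ominus>\<^bsub>W\<^esub> y)"
    if "x \<in> carrier W" "y \<in> carrier W" for x y
    using that P'(4)[of "x \<ominus>\<^bsub>W\<^esub> y" "x \<ominus>\<^bsub>W\<^esub> y"] by (simp add: hnorm_def)
  have "null_rel V `` {\<lambda>k. T (u k)} = fiber (P w)" if "u \<in> fiber w" for u
    using fiberD[OF that] w by (intro null_rel_fiber fiberI) (simp_all add: T J_T norm P'(1))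
  then show ?thesis using fiber_nonempty[OF w] by simp
qed

end


section \<open>Square-summable functions\<close>

lemma ell2_simps [simp]:
  "zero (ell2 X) = (\<lambda>x. 0)"
  "add (ell2 X) f g = (\<lambda>x. f x + g x)"
  "smult (ell2 X) c f = (\<lambda>x. c * f x)"
  "ip (ell2 X) f g = (\<Sum>\<^sub>\<infinity>x\<in>X. f x * cnj (g x))"
  by (simp_all add: ell2_def)

lemma ell2_carrier:
  "f \<in> carrier (ell2 X) \<longleftrightarrow>
     (\<forall>x. x \<notin> X \<longrightarrow> f x = 0) \<and> (\<lambda>x. (cmod (f x))\<^sup>2) summable_on X"
  by (simp add: ell2_def)

text \<open>The products are dominated by the sum of the two squares. Absolute summability is stated
  because Fubini for elementary tensors rests on it.\<close>

lemma ell2_abs_summable_mult: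
  assumes "f \<in> carrier (ell2 X)" "g \<in> carrier (ell2 X)"
  shows "(\<lambda>x. f x * cnj (g x)) abs_summable_on X"
proof (rule abs_summable_on_comparison_test')
  show "(\<lambda>x. (cmod (f x))\<^sup>2 + (cmod (g x))\<^sup>2) summable_on X"
    using assms by (intro summable_on_add) (auto simp: ell2_carrier)
  fix x
  have "2 * (cmod (f x) * cmod (g x)) \<le> (cmod (f x))\<^sup>2 + (cmod (g x))\<^sup>2"
    using sum_squares_bound[of "cmod (f x)" "cmod (g x)"] by simp
  moreover have "0 \<le> cmod (f x) * cmod (g x)" by simp
  ultimately show "cmod (f x * cnj (g x)) \<le> (cmod (f x))\<^sup>2 + (cmod (g x))\<^sup>2"
    unfolding norm_mult complex_mod_cnj by linarith
qed

lemmas ell2_summable_mult = abs_summable_summable[OF ell2_abs_summable_mult]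

lemma ell2_add_closed:
  assumes "f \<in> carrier (ell2 X)" "g \<in> carrier (ell2 X)"
  shows "(\<lambda>x. f x + g x) \<in> carrier (ell2 X)"
proof -
  have "(cmod (f x + g x))\<^sup>2 \<le> 2 * (cmod (f x))\<^sup>2 + 2 * (cmod (g x))\<^sup>2" for x
  proof -
    have "(cmod (f x + g x))\<^sup>2 \<le> (cmod (f x) + cmod (g x))\<^sup>2"
      by (intro power_mono norm_triangle_ineq norm_ge_zero)
    also have "\<dots> \<le> 2 * (cmod (f x))\<^sup>2 + 2 * (cmod (g x))\<^sup>2"
      using sum_squares_bound[of "cmod (f x)" "cmod (g x)"] by (simp add: power2_sum)
    finally show ?thesis .
  qed
  moreover have "(\<lambda>x. 2 * (cmod (f x))\<^sup>2 + 2 * (cmod (g x))\<^sup>2) summable_on X"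
    using assms by (intro summable_on_add summable_on_cmult_right) (auto simp: ell2_carrier)
  ultimately have "(\<lambda>x. (cmod (f x + g x))\<^sup>2) summable_on X"
    using summable_on_comparison_test[of "\<lambda>x. 2 * (cmod (f x))\<^sup>2 + 2 * (cmod (g x))\<^sup>2" X
        "\<lambda>x. (cmod (f x + g x))\<^sup>2"] by simp
  then show ?thesis using assms by (auto simp: ell2_carrier)
qed

lemma ell2_smult_closed: "f \<in> carrier (ell2 X) \<Longrightarrow> (\<lambda>x. c * f x) \<in> carrier (ell2 X)"
  by (auto simp: ell2_carrier norm_mult power_mult_distrib intro: summable_on_cmult_right)

lemma ell2_uminus_closed: "f \<in> carrier (ell2 X) \<Longrightarrow> (\<lambda>x. - f x) \<in> carrier (ell2 X)"
  using ell2_smult_closed[of f X "-1"] by simp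

lemma ell2_diff_closed:
  assumes "f \<in> carrier (ell2 X)" "g \<in> carrier (ell2 X)"
  shows "(\<lambda>x. f x - g x) \<in> carrier (ell2 X)"
  using ell2_add_closed[OF assms(1) ell2_uminus_closed[OF assms(2)]] by simp

lemma ell2_finite_support:
  assumes "finite F" "F \<subseteq> X" "\<And>x. x \<notin> F \<Longrightarrow> f x = 0"
  shows "f \<in> carrier (ell2 X)"
proof -
  have "(\<lambda>x. (cmod (f x))\<^sup>2) summable_on F" using assms(1) by simp
  also have "?this \<longleftrightarrow> (\<lambda>x. (cmod (f x))\<^sup>2) summable_on X"
    using assms by (intro summable_on_cong_neutral) auto
  finally show ?thesis using assms by (auto simp: ell2_carrier)
qed

lemma ell2_zero_closed: "(\<lambda>x. 0) \<in> carrier (ell2 X)"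
  by (rule ell2_finite_support[of "{}"]) auto

lemma ell2_sum_closed:
  assumes "\<And>p. p \<in> K \<Longrightarrow> h p \<in> carrier (ell2 X)"
  shows "(\<lambda>x. \<Sum>p\<in>K. c p * h p x) \<in> carrier (ell2 X)"
  using assms
  by (induction K rule: infinite_finite_induct)
     (auto simp: ell2_zero_closed intro!: ell2_add_closed ell2_smult_closed)

lemma abelian_group_ell2: "abelian_group (ell2 X)"
proof (rule abelian_groupI)
  fix f assume "f \<in> carrier (ell2 X)"
  then show "\<exists>g\<in>carrier (ell2 X). g \<oplus>\<^bsub>ell2 X\<^esub> f = \<zero>\<^bsub>ell2 X\<^esub>"
    by (intro bexI[of _ "\<lambda>x. - f x"]) (simp_all add: ell2_uminus_closed)
qed (auto simp: ell2_add_closed ell2_zero_closed)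

lemma ell2_minus:
  assumes "f \<in> carrier (ell2 X)" "g \<in> carrier (ell2 X)"
  shows "f \<ominus>\<^bsub>ell2 X\<^esub> g = (\<lambda>x. f x - g x)"
proof -
  interpret abelian_group "ell2 X" by (rule abelian_group_ell2)
  have "\<ominus>\<^bsub>ell2 X\<^esub> g = (\<lambda>x. - g x)"
    using assms(2) by (intro minus_equality) (simp_all add: ell2_uminus_closed)
  then show ?thesis by (simp add: minus_eq)
qed

lemma ell2_ip_self:
  assumes "f \<in> carrier (ell2 X)"
  shows "Re (ip (ell2 X) f f) = (\<Sum>\<^sub>\<infinity>x\<in>X. (cmod (f x))\<^sup>2)"
proof -
  have "Re (z * cnj z) = (cmod z)\<^sup>2" for z
    unfolding complex_norm_square[symmetric] by (rule Re_complex_of_real)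
  then show ?thesis
    using infsum_Re[OF ell2_summable_mult[OF assms assms]] by simp
qed

lemma ell2_hnorm_nonneg: "f \<in> carrier (ell2 X) \<Longrightarrow> hnorm (ell2 X) f \<ge> 0"
  unfolding hnorm_def ell2_ip_self by (simp add: infsum_nonneg)

lemma ell2_hnorm_square:
  "f \<in> carrier (ell2 X) \<Longrightarrow> (hnorm (ell2 X) f)\<^sup>2 = (\<Sum>\<^sub>\<infinity>x\<in>X. (cmod (f x))\<^sup>2)"
  unfolding hnorm_def ell2_ip_self by (simp add: infsum_nonneg)

lemma ell2_partial_sum_le:
  assumes "f \<in> carrier (ell2 X)" "finite F" "F \<subseteq> X"
  shows "(\<Sum>x\<in>F. (cmod (f x))\<^sup>2) \<le> (hnorm (ell2 X) f)\<^sup>2"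
  unfolding ell2_hnorm_square[OF assms(1)]
  using assms by (intro finite_sum_le_infsum) (auto simp: ell2_carrier)

text \<open>A partial sum with a single term. That evaluation at a point is contractive yields both
  the pointwise limits of Cauchy sequences and the definiteness of the inner product.\<close>

lemma ell2_coord_le:
  assumes "f \<in> carrier (ell2 X)"
  shows "cmod (f x) \<le> hnorm (ell2 X) f"
proof (cases "x \<in> X")
  case True
  then show ?thesis
    using ell2_partial_sum_le[OF assms, of "{x}"] ell2_hnorm_nonneg[OF assms]
    by (auto intro: power2_le_imp_le)
next
  case False
  then show ?thesis using assms ell2_hnorm_nonneg[OF assms] by (simp add: ell2_carrier)
qed

text \<open>Bounds on finite partial sums survive pointwise limits; this converts such bounds back
  into membership and a norm estimate.\<close>

lemma ell2_partial_sums_bounded: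
  assumes "\<And>x. x \<notin> X \<Longrightarrow> f x = 0" "B \<ge> 0"
    and bound: "\<And>F. \<lbrakk>finite F; F \<subseteq> X\<rbrakk> \<Longrightarrow> (\<Sum>x\<in>F. (cmod (f x))\<^sup>2) \<le> B\<^sup>2"
  shows "f \<in> carrier (ell2 X)" and "hnorm (ell2 X) f \<le> B"
proof -
  have s: "(\<lambda>x. (cmod (f x))\<^sup>2) summable_on X"
    by (rule nonneg_bdd_above_summable_on) (use bound in \<open>auto intro!: bdd_aboveI2\<close>)
  then show f: "f \<in> carrier (ell2 X)" using assms(1) by (simp add: ell2_carrier)
  have "(hnorm (ell2 X) f)\<^sup>2 \<le> B\<^sup>2"
    unfolding ell2_hnorm_square[OF f] by (rule infsum_le_finite_sums[OF s bound])
  then show "hnorm (ell2 X) f \<le> B" using assms(2) by (rule power2_le_imp_le)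
qed

lemma ell2_complete:
  assumes u: "u \<in> cauchy_seqs (ell2 X)"
  shows "\<exists>f\<in>carrier (ell2 X). (\<lambda>k. hnorm (ell2 X) (u k \<ominus>\<^bsub>ell2 X\<^esub> f)) \<longlonglongrightarrow> 0"
proof -
  let ?n = "hnorm (ell2 X)"
  have uc: "u k \<in> carrier (ell2 X)" for k using u by (simp add: cauchy_seqs_def)
  have dc: "(\<lambda>x. u k x - u l x) \<in> carrier (ell2 X)" for k l
    by (intro ell2_diff_closed uc)
  have cau: "\<exists>N. \<forall>k\<ge>N. \<forall>l\<ge>N. ?n (\<lambda>x. u k x - u l x) < e" if "e > 0" for e
    using u that by (simp add: cauchy_seqs_def ell2_minus[OF uc uc])
  have coord: "dist (u k x) (u l x) \<le> ?n (\<lambda>x. u k x - u l x)" for k l x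
    using ell2_coord_le[OF dc[of k l], of x] by (simp add: dist_norm)
  have "Cauchy (\<lambda>k. u k x)" for x
  proof (rule metric_CauchyI)
    fix e :: real assume "e > 0"
    from cau[OF this] show "\<exists>N. \<forall>k\<ge>N. \<forall>l\<ge>N. dist (u k x) (u l x) < e"
      using le_less_trans[OF coord] by blast
  qed
  then have "\<exists>l. (\<lambda>k. u k x) \<longlonglongrightarrow> l" for x
    by (simp add: Cauchy_convergent_iff convergent_def)
  then obtain f where f: "(\<lambda>k. u k x) \<longlonglongrightarrow> f x" for x by metis
  have zero: "f x = 0" if "x \<notin> X" for x
    using f[of x] uc that by (simp add: ell2_carrier LIMSEQ_const_iff)
  \<comment> \<open>With \<open>k\<close> and the finite set \<open>F\<close> fixed, letting
    \<open>l\<close> grow replaces \<open>u l\<close> by \<open>f\<close> in the partial sum, and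
    the bound \<open>e\<close> survives with \<le>. It does not depend on \<open>F\<close>.\<close>
  have tail: "\<exists>N. \<forall>k\<ge>N. (\<lambda>x. u k x - f x) \<in> carrier (ell2 X) \<and> ?n (\<lambda>x. u k x - f x) \<le> e"
    if e: "e > 0" for e
  proof -
    obtain N where N: "\<And>k l. k \<ge> N \<Longrightarrow> l \<ge> N \<Longrightarrow> ?n (\<lambda>x. u k x - u l x) < e"
      using cau[OF e] by blast
    have "(\<Sum>x\<in>F. (cmod (u k x - f x))\<^sup>2) \<le> e\<^sup>2" if "k \<ge> N" "finite F" "F \<subseteq> X" for k F
    proof (rule LIMSEQ_le_const2)
      show "(\<lambda>l. \<Sum>x\<in>F. (cmod (u k x - u l x))\<^sup>2) \<longlonglongrightarrow> (\<Sum>x\<in>F. (cmod (u k x - f x))\<^sup>2)"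
        by (intro tendsto_intros f)
      have "(\<Sum>x\<in>F. (cmod (u k x - u l x))\<^sup>2) \<le> e\<^sup>2" if "l \<ge> N" for l
        using ell2_partial_sum_le[OF dc \<open>finite F\<close> \<open>F \<subseteq> X\<close>, of k l]
          power_mono[OF less_imp_le[OF N[OF \<open>k \<ge> N\<close> that]] ell2_hnorm_nonneg[OF dc], of 2]
        by linarith
      then show "\<exists>N. \<forall>l\<ge>N. (\<Sum>x\<in>F. (cmod (u k x - u l x))\<^sup>2) \<le> e\<^sup>2" by blast
    qed
    then have "(\<lambda>x. u k x - f x) \<in> carrier (ell2 X) \<and> ?n (\<lambda>x. u k x - f x) \<le> e" if "k \<ge> N" for k
      using that e zero uc ell2_partial_sums_bounded[of X "\<lambda>x. u k x - f x" e]
      by (simp add: ell2_carrier)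
    then show ?thesis by blast
  qed
  \<comment> \<open>The pointwise limit is square-summable, being \<open>u N\<close> minus the
    square-summable difference \<open>u N - f\<close>.\<close>
  obtain N where "(\<lambda>x. u N x - f x) \<in> carrier (ell2 X)"
    using tail[of 1] by auto
  from ell2_diff_closed[OF uc this, of N] have fc: "f \<in> carrier (ell2 X)"
    by simp
  have "(\<lambda>k. ?n (u k \<ominus>\<^bsub>ell2 X\<^esub> f)) \<longlonglongrightarrow> 0"
  proof (rule LIMSEQ_I)
    fix r :: real assume "r > 0"
    then obtain N where "\<And>k. k \<ge> N \<Longrightarrow> ?n (\<lambda>x. u k x - f x) \<le> r / 2"
      using tail[of "r / 2"] by auto
    then show "\<exists>N. \<forall>k\<ge>N. norm (?n (u k \<ominus>\<^bsub>ell2 X\<^esub> f) - 0) < r"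
      using \<open>r > 0\<close> ell2_hnorm_nonneg[OF ell2_diff_closed[OF uc fc]]
      by (intro exI[of _ N]) (force simp: ell2_minus[OF uc fc])
  qed
  with fc show ?thesis by blast
qed

theorem hilbert_space_ell2: "hilbert_space (ell2 X)"
proof (rule hilbert_space.intro)
  show "Module.module complex_ring (ell2 X)"
    by (rule complex_moduleI[OF abelian_group_ell2])
       (simp_all add: ell2_smult_closed algebra_simps)
next
  show "hilbert_space_axioms (ell2 X)"
  proof
    fix f g h assume "f \<in> carrier (ell2 X)" "g \<in> carrier (ell2 X)" "h \<in> carrier (ell2 X)"
    then show "ip (ell2 X) (f \<oplus>\<^bsub>ell2 X\<^esub> g) h = ip (ell2 X) f h + ip (ell2 X) g h"
      by (simp add: distrib_right infsum_add ell2_summable_mult)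
  next
    fix c f g assume "f \<in> carrier (ell2 X)" "g \<in> carrier (ell2 X)"
    show "ip (ell2 X) (c \<odot>\<^bsub>ell2 X\<^esub> f) g = c * ip (ell2 X) f g"
      by (simp add: mult.assoc infsum_cmult_right')
    show "ip (ell2 X) g f = cnj (ip (ell2 X) f g)"
      by (simp flip: infsum_cnj add: mult.commute)
  next
    fix f assume f: "f \<in> carrier (ell2 X)"
    show "0 \<le> Re (ip (ell2 X) f f)"
      using ell2_hnorm_nonneg[OF f] by (simp add: hnorm_def)
    assume "ip (ell2 X) f f = 0"
    then have "hnorm (ell2 X) f = 0" by (simp add: hnorm_def)
    then show "f = \<zero>\<^bsub>ell2 X\<^esub>"
      using ell2_coord_le[OF f] by (auto intro!: ext)
  qed (rule ell2_complete)
qed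

lemma ell2_finite_support_dense:
  assumes w: "w \<in> carrier (ell2 X)" and "e > 0"
  obtains F where "finite F" "F \<subseteq> X"
    "hnorm (ell2 X) ((\<lambda>x. if x \<in> F then w x else 0) \<ominus>\<^bsub>ell2 X\<^esub> w) < e"
proof -
  have s: "(\<lambda>x. (cmod (w x))\<^sup>2) summable_on X" using w by (simp add: ell2_carrier)
  \<comment> \<open>The squared error is the part of the sum of squares outside \<open>F\<close>.
    The approximation comes with \<le>, so half of the square of \<open>e\<close> leaves room for
    the strict inequality.\<close>
  obtain F where F: "finite F" "F \<subseteq> X"
    "dist (\<Sum>x\<in>F. (cmod (w x))\<^sup>2) (\<Sum>\<^sub>\<infinity>x\<in>X. (cmod (w x))\<^sup>2) \<le> e\<^sup>2 / 2"
    using infsum_finite_approximation[OF s, of "e\<^sup>2 / 2"] \<open>e > 0\<close> by auto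
  let ?v = "\<lambda>x. if x \<in> F then w x else 0"
  have v: "?v \<in> carrier (ell2 X)" using F by (intro ell2_finite_support[of F]) auto
  have "(hnorm (ell2 X) (?v \<ominus>\<^bsub>ell2 X\<^esub> w))\<^sup>2 = (\<Sum>\<^sub>\<infinity>x\<in>X. (cmod (?v x - w x))\<^sup>2)"
    using v w by (simp add: ell2_minus ell2_hnorm_square ell2_diff_closed)
  also have "\<dots> = (\<Sum>\<^sub>\<infinity>x\<in>X - F. (cmod (w x))\<^sup>2)"
    by (intro infsum_cong_neutral) auto
  also have "\<dots> = (\<Sum>\<^sub>\<infinity>x\<in>X. (cmod (w x))\<^sup>2) - (\<Sum>x\<in>F. (cmod (w x))\<^sup>2)"
    using F s by (subst infsum_Diff) auto
  also have "\<dots> \<le> e\<^sup>2 / 2" using F(3) unfolding dist_real_def by linarith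
  also have "\<dots> < e\<^sup>2" using \<open>e > 0\<close> by simp
  finally have "hnorm (ell2 X) (?v \<ominus>\<^bsub>ell2 X\<^esub> w) < e"
    by (rule power2_less_imp_less) (use \<open>e > 0\<close> in simp)
  with F(1,2) show thesis by (rule that)
qed


section \<open>Tensor products of square-summable functions\<close>

text \<open>The inner sum of norms is \<open>norm (f x)\<close> times a constant, which gives
  absolute summability on the product. This justifies Fubini, and both factors come out of the
  iterated sum.\<close>

lemma
  fixes f :: "'a \<Rightarrow> complex" and g :: "'b \<Rightarrow> complex"
  assumes f: "f abs_summable_on X" and g: "g abs_summable_on Y"
  shows abs_summable_on_prod: "(\<lambda>z. f (fst z) * g (snd z)) abs_summable_on X \<times> Y"
    and infsum_prod: "(\<Sum>\<^sub>\<infinity>z\<in>X \<times> Y. f (fst z) * g (snd z)) = infsum f X * infsum g Y"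
proof -
  have "(\<lambda>x. norm (\<Sum>\<^sub>\<infinity>y\<in>Y. norm (f x * g y))) = (\<lambda>x. norm (f x) * (\<Sum>\<^sub>\<infinity>y\<in>Y. norm (g y)))"
    by (simp add: norm_mult infsum_cmult_right' abs_mult infsum_nonneg)
  moreover have "(\<lambda>x. norm (f x) * (\<Sum>\<^sub>\<infinity>y\<in>Y. norm (g y))) summable_on X"
    using f by (rule summable_on_cmult_left)
  moreover have "(\<lambda>y. norm (f x * g y)) summable_on Y" for x
    using summable_on_cmult_right[OF g, of "norm (f x)"] by (simp add: norm_mult)
  ultimately show s: "(\<lambda>z. f (fst z) * g (snd z)) abs_summable_on X \<times> Y"
    unfolding abs_summable_on_Sigma_iff by simp
  show "(\<Sum>\<^sub>\<infinity>z\<in>X \<times> Y. f (fst z) * g (snd z)) = infsum f X * infsum g Y"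
    using infsum_Sigma_banach[OF abs_summable_summable[OF s]]
    by (simp add: infsum_cmult_right' infsum_cmult_left')
qed

lemma
  fixes f :: "'i \<Rightarrow> 'a \<Rightarrow> complex"
  assumes "\<And>p. p \<in> K \<Longrightarrow> f p summable_on A"
  shows summable_on_sum: "(\<lambda>x. \<Sum>p\<in>K. f p x) summable_on A"
    and infsum_sum: "(\<Sum>\<^sub>\<infinity>x\<in>A. \<Sum>p\<in>K. f p x) = (\<Sum>p\<in>K. infsum (f p) A)"
proof -
  have "(\<lambda>x. \<Sum>p\<in>K. f p x) summable_on A \<and>
      (\<Sum>\<^sub>\<infinity>x\<in>A. \<Sum>p\<in>K. f p x) = (\<Sum>p\<in>K. infsum (f p) A)"
    using assms
    by (induction K rule: infinite_finite_induct) (auto simp: summable_on_add infsum_add)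
  then show "(\<lambda>x. \<Sum>p\<in>K. f p x) summable_on A"
    "(\<Sum>\<^sub>\<infinity>x\<in>A. \<Sum>p\<in>K. f p x) = (\<Sum>p\<in>K. infsum (f p) A)" by auto
qed

definition elem_tensor :: "('a \<Rightarrow> complex) \<times> ('b \<Rightarrow> complex) \<Rightarrow> 'a \<times> 'b \<Rightarrow> complex" where
  "elem_tensor p z = fst p (fst z) * snd p (snd z)"

lemma elem_tensor_closed:
  assumes "p \<in> carrier (ell2 X) \<times> carrier (ell2 Y)"
  shows "elem_tensor p \<in> carrier (ell2 (X \<times> Y))"
proof -
  \<comment> \<open>The squared moduli are written as complex numbers because
    \<open>abs_summable_on_prod\<close> speaks of complex functions; their norms are the real
    squares again.\<close>
  have "(\<lambda>z. of_real ((cmod (fst p (fst z)))\<^sup>2) * of_real ((cmod (snd p (snd z)))\<^sup>2) :: complex)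
      abs_summable_on X \<times> Y"
    using assms by (intro abs_summable_on_prod[of "\<lambda>x. of_real ((cmod (fst p x))\<^sup>2)" X
          "\<lambda>y. of_real ((cmod (snd p y))\<^sup>2)" Y]) (auto simp: ell2_carrier norm_power)
  then show ?thesis
    using assms
    by (auto simp: ell2_carrier elem_tensor_def norm_mult norm_power power_mult_distrib)
qed

lemma elem_tensor_ip:
  assumes "p \<in> carrier (ell2 X) \<times> carrier (ell2 Y)" "q \<in> carrier (ell2 X) \<times> carrier (ell2 Y)"
  shows "ip (ell2 (X \<times> Y)) (elem_tensor p) (elem_tensor q)
       = ip (ell2 X) (fst p) (fst q) * ip (ell2 Y) (snd p) (snd q)"
proof -
  have "(\<Sum>\<^sub>\<infinity>z\<in>X \<times> Y. elem_tensor p z * cnj (elem_tensor q z))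
    = (\<Sum>\<^sub>\<infinity>z\<in>X \<times> Y. (fst p (fst z) * cnj (fst q (fst z))) * (snd p (snd z) * cnj (snd q (snd z))))"
    by (simp add: elem_tensor_def mult_ac)
  also have "\<dots> = (\<Sum>\<^sub>\<infinity>x\<in>X. fst p x * cnj (fst q x)) * (\<Sum>\<^sub>\<infinity>y\<in>Y. snd p y * cnj (snd q y))"
    using assms by (intro infsum_prod[of "\<lambda>x. fst p x * cnj (fst q x)" X
          "\<lambda>y. snd p y * cnj (snd q y)" Y] ell2_abs_summable_mult) auto
  finally show ?thesis by simp
qed

text \<open>The linear extension of \<open>elem_tensor\<close> to formal sums. By
  \<open>tensor_fun_ip\<close> the formal sums it kills are those of norm 0, which the completion
  identifies with zero.\<close>

definition tensor_fun ::
    "(('a \<Rightarrow> complex) \<times> ('b \<Rightarrow> complex) \<Rightarrow>\<^sub>0 complex) \<Rightarrow> 'a \<times> 'b \<Rightarrow> complex" where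
  "tensor_fun s z = (\<Sum>p\<in>Poly_Mapping.keys s. Poly_Mapping.lookup s p * elem_tensor p z)"

lemma free_tensor_simps [simp]:
  "s \<in> carrier (free_tensor V W) \<longleftrightarrow> Poly_Mapping.keys s \<subseteq> carrier V \<times> carrier W"
  "zero (free_tensor V W) = 0" "add (free_tensor V W) = (+)"
  "smult (free_tensor V W) c s = Poly_Mapping.map ((*) c) s"
  by (simp_all add: free_tensor_def)

lemma abelian_group_free_tensor: "abelian_group (free_tensor V W)"
proof (rule abelian_groupI)
  fix s t assume "s \<in> carrier (free_tensor V W)" "t \<in> carrier (free_tensor V W)"
  then show "s \<oplus>\<^bsub>free_tensor V W\<^esub> t \<in> carrier (free_tensor V W)"
    using keys_add[of s t] by auto
next
  fix s assume "s \<in> carrier (free_tensor V W)"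
  then show "\<exists>t\<in>carrier (free_tensor V W). t \<oplus>\<^bsub>free_tensor V W\<^esub> s = \<zero>\<^bsub>free_tensor V W\<^esub>"
    by (intro bexI[of _ "- s"]) simp_all
qed (simp_all add: add_ac)

lemma lookup_scale: "Poly_Mapping.lookup (Poly_Mapping.map ((*) c) s) p = c * Poly_Mapping.lookup s p"
  for c :: complex
  by (simp add: Poly_Mapping.map.rep_eq when_def)

lemma keys_scale: "Poly_Mapping.keys (Poly_Mapping.map ((*) c) s) \<subseteq> Poly_Mapping.keys s"
  for c :: complex
  by (auto simp: in_keys_iff lookup_scale)

lemma tensor_fun_add: "tensor_fun (s + t) = (\<lambda>z. tensor_fun s z + tensor_fun t z)"
  unfolding tensor_fun_def
  by (intro ext setsum_keys_plus_distrib[of "\<lambda>p c. c * elem_tensor p z" for z])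
     (simp_all add: distrib_right)

lemma tensor_fun_scale: "tensor_fun (Poly_Mapping.map ((*) c) s) = (\<lambda>z. c * tensor_fun s z)"
proof
  fix z
  have "tensor_fun (Poly_Mapping.map ((*) c) s) z
      = (\<Sum>p\<in>Poly_Mapping.keys s. c * Poly_Mapping.lookup s p * elem_tensor p z)"
    unfolding tensor_fun_def lookup_scale
    by (intro sum.mono_neutral_left keys_scale) (auto simp: in_keys_iff lookup_scale)
  then show "tensor_fun (Poly_Mapping.map ((*) c) s) z = c * tensor_fun s z"
    by (simp add: tensor_fun_def sum_distrib_left mult.assoc)
qed

lemma tensor_fun_single: "tensor_fun (Poly_Mapping.single p c) = (\<lambda>z. c * elem_tensor p z)"
  by (simp add: tensor_fun_def fun_eq_iff)

lemma tensor_fun_sum: "tensor_fun (sum h K) = (\<lambda>z. \<Sum>i\<in>K. tensor_fun (h i) z)"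
proof (induction K rule: infinite_finite_induct)
  case (insert i K)
  then show ?case by (simp add: tensor_fun_add)
qed (simp_all add: tensor_fun_def fun_eq_iff)

lemma tensor_fun_closed:
  assumes "s \<in> carrier (free_tensor (ell2 X) (ell2 Y))"
  shows "tensor_fun s \<in> carrier (ell2 (X \<times> Y))"
  unfolding tensor_fun_def
  using assms by (intro ell2_sum_closed elem_tensor_closed) auto

text \<open>The form on \<open>free_tensor\<close> is defined by its sesquilinear expansion. Pulling
  the finite sums over keys out of the sum over pairs leaves the case of two elementary
  tensors.\<close>

lemma tensor_fun_ip:
  assumes s: "s \<in> carrier (free_tensor (ell2 X) (ell2 Y))"
    and t: "t \<in> carrier (free_tensor (ell2 X) (ell2 Y))"
  shows "ip (ell2 (X \<times> Y)) (tensor_fun s) (tensor_fun t) = ip (free_tensor (ell2 X) (ell2 Y)) s t"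
proof -
  let ?S = "Poly_Mapping.keys s" and ?T = "Poly_Mapping.keys t"
  let ?c = "\<lambda>p q. Poly_Mapping.lookup s p * cnj (Poly_Mapping.lookup t q)"
  have summable: "(\<lambda>z. ?c p q * (elem_tensor p z * cnj (elem_tensor q z))) summable_on X \<times> Y"
    if "p \<in> ?S" "q \<in> ?T" for p q
    using s t that
    by (intro summable_on_cmult_right ell2_summable_mult elem_tensor_closed) auto
  have "ip (ell2 (X \<times> Y)) (tensor_fun s) (tensor_fun t)
      = (\<Sum>\<^sub>\<infinity>z\<in>X \<times> Y. \<Sum>p\<in>?S. \<Sum>q\<in>?T. ?c p q * (elem_tensor p z * cnj (elem_tensor q z)))"
    by (simp add: tensor_fun_def sum_product mult_ac)
  also have "\<dots> = (\<Sum>p\<in>?S. \<Sum>q\<in>?T. \<Sum>\<^sub>\<infinity>z\<in>X \<times> Y. ?c p q * (elem_tensor p z * cnj (elem_tensor q z)))"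
    using summable by (simp add: infsum_sum summable_on_sum)
  also have "\<dots> = (\<Sum>p\<in>?S. \<Sum>q\<in>?T. ?c p q * ip (ell2 (X \<times> Y)) (elem_tensor p) (elem_tensor q))"
    by (simp only: infsum_cmult_right' ell2_simps)
  also have "\<dots> = ip (free_tensor (ell2 X) (ell2 Y)) s t"
    using s t by (auto simp: free_tensor_def intro!: sum.cong arg_cong2[of _ _ _ _ "(*)"]
        elem_tensor_ip simp del: ell2_simps)
  finally show ?thesis .
qed

lemma tensor_fun_dense:
  assumes w: "w \<in> carrier (ell2 (X \<times> Y))" and "e > 0"
  shows "\<exists>s\<in>carrier (free_tensor (ell2 X) (ell2 Y)).
           hnorm (ell2 (X \<times> Y)) (tensor_fun s \<ominus>\<^bsub>ell2 (X \<times> Y)\<^esub> w) < e"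
proof -
  obtain F where F: "finite F" "F \<subseteq> X \<times> Y"
    "hnorm (ell2 (X \<times> Y)) ((\<lambda>x. if x \<in> F then w x else 0) \<ominus>\<^bsub>ell2 (X \<times> Y)\<^esub> w) < e"
    using ell2_finite_support_dense[OF w \<open>e > 0\<close>] .
  \<comment> \<open>The two point masses at the coordinates of \<open>a\<close>; their elementary
    tensor is the point mass at \<open>a\<close>, so finitely supported functions are evaluations of
    formal sums.\<close>
  define b :: "'a \<times> 'b \<Rightarrow> ('a \<Rightarrow> complex) \<times> ('b \<Rightarrow> complex)"
    where "b a = (\<lambda>x. of_bool (x = fst a), \<lambda>y. of_bool (y = snd a))" for a
  define s where "s = (\<Sum>a\<in>F. Poly_Mapping.single (b a) (w a))"
  have "b a \<in> carrier (ell2 X) \<times> carrier (ell2 Y)" if "a \<in> F" for a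
    using that F(2) ell2_finite_support[of "{fst a}" X "\<lambda>x. of_bool (x = fst a)"]
      ell2_finite_support[of "{snd a}" Y "\<lambda>y. of_bool (y = snd a)"]
    by (auto simp: b_def)
  then have "s \<in> carrier (free_tensor (ell2 X) (ell2 Y))"
    unfolding s_def free_tensor_simps
    by (intro order_trans[OF keys_sum] UN_least) (auto split: if_splits)
  moreover have "elem_tensor (b a) z = of_bool (z = a)" for a z
    by (cases a; cases z) (simp add: elem_tensor_def b_def)
  then have "tensor_fun s = (\<lambda>z. if z \<in> F then w z else 0)"
    using F(1) by (simp add: s_def tensor_fun_sum tensor_fun_single fun_eq_iff of_bool_def
        if_distrib[of "\<lambda>x. _ * x"] cong: if_cong)
  ultimately show ?thesis using F(3) by (intro bexI[of _ s]) simp_all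
qed

text \<open>The completion of this domain is \<open>hilb_tensor (ell2 X) (ell2 Y)\<close>, so
  \<open>tensor.fiber X Y\<close> becomes the unitary from \<open>ell2 (X \<times> Y)\<close> onto
  the Hilbert space tensor product.\<close>

interpretation tensor: dense_isometry "ell2 (X \<times> Y)" "free_tensor (ell2 X) (ell2 Y)" tensor_fun
  for X :: "'a set" and Y :: "'b set"
proof (rule dense_isometry.intro[OF hilbert_space_ell2 abelian_group_free_tensor], unfold_locales)
  fix s and c :: complex assume "s \<in> carrier (free_tensor (ell2 X) (ell2 Y))"
  then show "c \<odot>\<^bsub>free_tensor (ell2 X) (ell2 Y)\<^esub> s \<in> carrier (free_tensor (ell2 X) (ell2 Y))"
    using keys_scale[of c s] by auto
qed (simp_all add: tensor_fun_add tensor_fun_scale tensor_fun_closed tensor_fun_ip tensor_fun_dense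
      del: ell2_simps(4) free_tensor_simps(1))

text \<open>Two keys of \<open>s\<close> may have the same image under \<open>map_prod A B\<close>,
  and their coefficients then add up. Evaluating before terms are collected keeps the sum indexed by
  the keys of \<open>s\<close>.\<close>

lemma tensor_fun_op:
  "tensor_fun (free_tensor_op A B s) z =
     (\<Sum>p\<in>Poly_Mapping.keys s. Poly_Mapping.lookup s p * elem_tensor (map_prod A B p) z)"
  by (simp add: free_tensor_op_def tensor_fun_sum tensor_fun_single)

lemma free_tensor_op_closed:
  assumes "s \<in> carrier (free_tensor V W)"
    and "\<And>x. x \<in> carrier V \<Longrightarrow> A x \<in> carrier V" "\<And>y. y \<in> carrier W \<Longrightarrow> B y \<in> carrier W"
  shows "free_tensor_op A B s \<in> carrier (free_tensor V W)"
  unfolding free_tensor_op_def free_tensor_simps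
  using assms by (intro order_trans[OF keys_sum] UN_least) (auto split: if_splits)


section \<open>Direct sums of square-summable functions\<close>

text \<open>Two defaults are at work: outside \<open>I\<close> the restriction gives
  \<open>undefined\<close>, as the extensional families of \<open>hilb_sum\<close> require; outside
  \<open>X i\<close> the value is 0, as \<open>ell2\<close> requires.\<close>

definition split_fun :: "'i set \<Rightarrow> ('i \<Rightarrow> 'a set) \<Rightarrow> ('i \<times> 'a \<Rightarrow> 'b) \<Rightarrow> ('b \<Rightarrow> complex) \<Rightarrow>
    'i \<Rightarrow> 'a \<Rightarrow> complex" where
  "split_fun I X b f = (\<lambda>i\<in>I. \<lambda>x. if x \<in> X i then f (b (i, x)) else 0)"

lemma hilb_sum_simps [simp]:
  "zero (hilb_sum I V) = (\<lambda>i\<in>I. \<zero>\<^bsub>V i\<^esub>)"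
  "add (hilb_sum I V) f g = (\<lambda>i\<in>I. f i \<oplus>\<^bsub>V i\<^esub> g i)"
  "smult (hilb_sum I V) c f = (\<lambda>i\<in>I. c \<odot>\<^bsub>V i\<^esub> f i)"
  "ip (hilb_sum I V) f g = (\<Sum>\<^sub>\<infinity>i\<in>I. ip (V i) (f i) (g i))"
  by (simp_all add: hilb_sum_def)

text \<open>Tonelli: square-summability of each component and of the family of norms is one
  summability over the disjoint union. The squares pass through complex numbers to fit the criterion
  for absolute summability on a \<open>Sigma\<close>.\<close>

lemma hilb_sum_ell2_carrier:
  "f \<in> carrier (hilb_sum I (\<lambda>i. ell2 (X i))) \<longleftrightarrow>
     f \<in> extensional I \<and> (\<forall>i\<in>I. \<forall>x. x \<notin> X i \<longrightarrow> f i x = 0) \<and>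
     (\<lambda>(i, x). (cmod (f i x))\<^sup>2) summable_on Sigma I X"
proof -
  let ?g = "\<lambda>(i, x). complex_of_real ((cmod (f i x))\<^sup>2)"
  have g: "norm (?g z) = (\<lambda>(i, x). (cmod (f i x))\<^sup>2) z" for z
    by (cases z) (simp add: norm_power)
  have "(\<lambda>(i, x). (cmod (f i x))\<^sup>2) summable_on Sigma I X \<longleftrightarrow>
      (\<forall>i\<in>I. (\<lambda>x. (cmod (f i x))\<^sup>2) summable_on X i) \<and>
      (\<lambda>i. \<Sum>\<^sub>\<infinity>x\<in>X i. (cmod (f i x))\<^sup>2) summable_on I"
    using abs_summable_on_Sigma_iff[of ?g I X] unfolding g
    by (simp add: abs_of_nonneg infsum_nonneg)
  moreover have "(\<lambda>i. (hnorm (ell2 (X i)) (f i))\<^sup>2) summable_on I \<longleftrightarrow>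
      (\<lambda>i. \<Sum>\<^sub>\<infinity>x\<in>X i. (cmod (f i x))\<^sup>2) summable_on I"
    if "\<forall>i\<in>I. f i \<in> carrier (ell2 (X i))"
    using that by (intro summable_on_cong ell2_hnorm_square) blast
  ultimately show ?thesis
    by (auto simp: hilb_sum_def PiE_iff ell2_carrier)
qed

text \<open>Reindexing along \<open>b\<close> turns sums over \<open>E\<close> into sums over the
  disjoint union, which Fubini turns into the iterated sums of \<open>hilb_sum\<close>.\<close>

lemma split_fun_unitary:
  assumes b: "bij_betw b (Sigma I X) E"
  shows "unitary_op (ell2 E) (hilb_sum I (\<lambda>i. ell2 (X i))) (split_fun I X b)"
proof -
  let ?S = "hilb_sum I (\<lambda>i. ell2 (X i))" and ?U = "split_fun I X b"
  have bE: "b (i, x) \<in> E" if "i \<in> I" "x \<in> X i" for i x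
    using that b by (auto simp: bij_betw_def)
  have closed: "?U f \<in> carrier ?S" if "f \<in> carrier (ell2 E)" for f
  proof -
    have "(\<lambda>e. (cmod (f e))\<^sup>2) summable_on E" using that by (simp add: ell2_carrier)
    then have "(\<lambda>z. (cmod (f (b z)))\<^sup>2) summable_on Sigma I X"
      using summable_on_reindex_bij_betw[OF b, of "\<lambda>e. (cmod (f e))\<^sup>2"] by simp
    also have "?this \<longleftrightarrow> (\<lambda>(i, x). (cmod (?U f i x))\<^sup>2) summable_on Sigma I X"
      by (intro summable_on_cong) (auto simp: split_fun_def)
    finally show ?thesis
      by (auto simp: hilb_sum_ell2_carrier split_fun_def)
  qed
  have "inj_on ?U (carrier (ell2 E))"
  proof (intro inj_onI ext)
    fix f g e assume f: "f \<in> carrier (ell2 E)" and g: "g \<in> carrier (ell2 E)" and eq: "?U f = ?U g"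
    show "f e = g e"
    proof (cases "e \<in> E")
      case True
      then obtain i x where ix: "i \<in> I" "x \<in> X i" "e = b (i, x)"
        using b by (force simp: bij_betw_def)
      then show ?thesis using fun_cong[OF fun_cong[OF eq], of i x] by (simp add: split_fun_def)
    next
      case False
      then show ?thesis using f g by (simp add: ell2_carrier)
    qed
  qed
  moreover have "h \<in> ?U ` carrier (ell2 E)" if h: "h \<in> carrier ?S" for h
  proof
    define f where "f e = (if e \<in> E then case inv_into (Sigma I X) b e of (i, x) \<Rightarrow> h i x else 0)" for e
    have fb: "f (b (i, x)) = h i x" if "i \<in> I" "x \<in> X i" for i x
      using that b bE[OF that] by (simp add: f_def bij_betw_inv_into_left[OF b])
    show "h = ?U f"
      using h fb by (auto simp: hilb_sum_ell2_carrier split_fun_def fun_eq_iff extensional_def)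
    have "(\<lambda>z. (cmod (f (b z)))\<^sup>2) summable_on Sigma I X \<longleftrightarrow>
        (\<lambda>(i, x). (cmod (h i x))\<^sup>2) summable_on Sigma I X"
      by (intro summable_on_cong) (auto simp: fb)
    then have "(\<lambda>e. (cmod (f e))\<^sup>2) summable_on E"
      using h summable_on_reindex_bij_betw[OF b, of "\<lambda>e. (cmod (f e))\<^sup>2"]
      by (simp add: hilb_sum_ell2_carrier)
    then show "f \<in> carrier (ell2 E)" by (simp add: ell2_carrier f_def)
  qed
  ultimately have "bij_betw ?U (carrier (ell2 E)) (carrier ?S)"
    using closed by (auto simp: bij_betw_def)
  moreover have "ip ?S (?U f) (?U g) = ip (ell2 E) f g"
    if "f \<in> carrier (ell2 E)" "g \<in> carrier (ell2 E)" for f g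
  proof -
    have s: "(\<lambda>z. f (b z) * cnj (g (b z))) summable_on Sigma I X"
      using ell2_summable_mult[OF that] summable_on_reindex_bij_betw[OF b, of "\<lambda>e. f e * cnj (g e)"]
      by simp
    have "ip ?S (?U f) (?U g) = (\<Sum>\<^sub>\<infinity>i\<in>I. \<Sum>\<^sub>\<infinity>x\<in>X i. f (b (i, x)) * cnj (g (b (i, x))))"
      by (auto simp: split_fun_def intro!: infsum_cong)
    also have "\<dots> = (\<Sum>\<^sub>\<infinity>z\<in>Sigma I X. f (b z) * cnj (g (b z)))"
      using infsum_Sigma_banach[OF s] by simp
    also have "\<dots> = ip (ell2 E) f g"
      using infsum_reindex_bij_betw[OF b, of "\<lambda>e. f e * cnj (g e)"] by simp
    finally show ?thesis .
  qed
  ultimately show ?thesis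
    by (auto simp: unitary_op_def split_fun_def fun_eq_iff restrict_def)
qed

lemma split_fun_zero:
  "split_fun I X b \<zero>\<^bsub>ell2 E\<^esub> = \<zero>\<^bsub>hilb_sum I (\<lambda>i. ell2 (X i))\<^esub>"
  by (simp add: split_fun_def fun_eq_iff restrict_def)


section \<open>Unitary equivalence\<close>

text \<open>On the image space every operator of \<open>\<rho>\<close> is the conjugate by
  \<open>U\<close> of one of \<open>\<sigma>\<close>. Thus the intertwining relation also yields
  that \<open>\<rho>\<close> is a unitary representation, as the definition of equivalence
  demands.\<close>

lemma unitary_rep_transport:
  assumes \<sigma>: "unitary_rep G \<sigma>" and U: "unitary_op (rep_space \<sigma>) (rep_space \<rho>) U"
    and zero: "U \<zero>\<^bsub>rep_space \<sigma>\<^esub> = \<zero>\<^bsub>rep_space \<rho>\<^esub>"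
    and act: "\<And>g x. \<lbrakk>g \<in> carrier G; x \<in> carrier (rep_space \<sigma>)\<rbrakk>
      \<Longrightarrow> rep_act \<rho> g (U x) = U (rep_act \<sigma> g x)"
  shows "unitarily_equivalent G \<sigma> \<rho>"
proof -
  let ?V = "rep_space \<sigma>" and ?W = "rep_space \<rho>"
  interpret G: group G using \<sigma> by (simp add: unitary_rep_def)
  have V: "hilbert_space ?V" using \<sigma> by (simp add: unitary_rep_def)
  have unit: "unitary_op ?V ?V (rep_act \<sigma> g)" if "g \<in> carrier G" for g
    using \<sigma> that by (simp add: unitary_rep_def)
  have mult: "rep_act \<sigma> (g \<otimes>\<^bsub>G\<^esub> h) x = rep_act \<sigma> g (rep_act \<sigma> h x)"
    if "g \<in> carrier G" "h \<in> carrier G" "x \<in> carrier ?V" for g h x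
    using \<sigma> that by (simp add: unitary_rep_def)
  interpret W: hilbert_space ?W by (rule hilbert_space_transport[OF V U zero])
  note U' = unitary_opD[OF U]
  let ?I = "inv_into (carrier ?V) U"
  have I: "unitary_op ?W ?V ?I" by (rule unitary_op_inv[OF V U])
  have UI: "U (?I y) = y" if "y \<in> carrier ?W" for y
    using that U'(1) by (auto simp: bij_betw_def f_inv_into_f)
  have conj: "rep_act \<rho> g y = (U \<circ> (rep_act \<sigma> g \<circ> ?I)) y"
    if "g \<in> carrier G" "y \<in> carrier ?W" for g y
    using act[OF that(1) unitary_opD(2)[OF I that(2)]] UI[OF that(2)] by simp
  have "unitary_op ?W ?W (rep_act \<rho> g)" if g: "g \<in> carrier G" for g
  proof -
    have "unitary_op ?W ?W (U \<circ> (rep_act \<sigma> g \<circ> ?I))"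
      by (rule unitary_op_comp[OF unitary_op_comp[OF I unit[OF g]] U])
    \<comment> \<open>The two maps are known to agree on \<open>carrier ?W\<close> only, so
      bijectivity is transferred by congruence on that set.\<close>
    moreover have "bij_betw (rep_act \<rho> g) (carrier ?W) (carrier ?W) \<longleftrightarrow>
        bij_betw (U \<circ> (rep_act \<sigma> g \<circ> ?I)) (carrier ?W) (carrier ?W)"
      by (rule bij_betw_cong) (rule conj[OF g])
    ultimately show ?thesis
      unfolding unitary_op_def using W.smult_carrier by (simp add: conj[OF g] del: comp_apply)
  qed
  moreover have "rep_act \<rho> (g \<otimes>\<^bsub>G\<^esub> h) y = rep_act \<rho> g (rep_act \<rho> h y)"
    if g: "g \<in> carrier G" "h \<in> carrier G" and y: "y \<in> carrier ?W" for g h y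
  proof -
    obtain x where x: "x \<in> carrier ?V" "y = U x"
      using y U'(1) by (auto simp: bij_betw_def)
    then show ?thesis
      using g unitary_opD(2)[OF unit[OF g(2)] x(1)] by (simp add: act mult)
  qed
  ultimately have "unitary_rep G \<rho>"
    by (simp add: unitary_rep_def G.group_axioms W.hilbert_space_axioms)
  moreover have "\<forall>g\<in>carrier G. \<forall>x\<in>carrier ?V. U (rep_act \<sigma> g x) = rep_act \<rho> g (U x)"
    by (simp add: act)
  ultimately show ?thesis
    using \<sigma> U unfolding unitarily_equivalent_def by blast
qed

lemma unitarily_equivalent_sym:
  assumes "unitarily_equivalent G \<rho> \<sigma>"
  shows "unitarily_equivalent G \<sigma> \<rho>"
proof -
  let ?V = "rep_space \<rho>" and ?W = "rep_space \<sigma>"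
  obtain U where \<rho>: "unitary_rep G \<rho>" and \<sigma>: "unitary_rep G \<sigma>" and U: "unitary_op ?V ?W U"
    and act: "\<And>g x. g \<in> carrier G \<Longrightarrow> x \<in> carrier ?V \<Longrightarrow> U (rep_act \<rho> g x) = rep_act \<sigma> g (U x)"
    using assms by (auto simp: unitarily_equivalent_def)
  let ?I = "inv_into (carrier ?V) U"
  note U' = unitary_opD[OF U]
  have "?I (rep_act \<sigma> g y) = rep_act \<rho> g (?I y)" if g: "g \<in> carrier G" and y: "y \<in> carrier ?W" for g y
  proof -
    obtain x where x: "x \<in> carrier ?V" "y = U x"
      using y U'(1) by (auto simp: bij_betw_def)
    have "rep_act \<rho> g x \<in> carrier ?V"
      using \<rho> g unitary_opD(2)[OF _ x(1), of ?V "rep_act \<rho> g"] by (simp add: unitary_rep_def)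
    then show ?thesis
      using x g U'(1) by (simp add: bij_betw_def flip: act)
  qed
  moreover have "unitary_op ?W ?V ?I"
    using \<rho> by (intro unitary_op_inv[OF _ U]) (simp add: unitary_rep_def)
  ultimately show ?thesis
    using \<rho> \<sigma> unfolding unitarily_equivalent_def by blast
qed

lemma unitarily_equivalent_trans:
  assumes "unitarily_equivalent G \<rho> \<sigma>" "unitarily_equivalent G \<sigma> \<tau>"
  shows "unitarily_equivalent G \<rho> \<tau>"
proof -
  obtain U where U: "unitary_op (rep_space \<rho>) (rep_space \<sigma>) U"
    and Ua: "\<And>g x. g \<in> carrier G \<Longrightarrow> x \<in> carrier (rep_space \<rho>) \<Longrightarrow> U (rep_act \<rho> g x) = rep_act \<sigma> g (U x)"
    using assms(1) by (auto simp: unitarily_equivalent_def)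
  obtain T where T: "unitary_op (rep_space \<sigma>) (rep_space \<tau>) T"
    and Ta: "\<And>g x. g \<in> carrier G \<Longrightarrow> x \<in> carrier (rep_space \<sigma>) \<Longrightarrow> T (rep_act \<sigma> g x) = rep_act \<tau> g (T x)"
    using assms(2) by (auto simp: unitarily_equivalent_def)
  have "\<forall>g\<in>carrier G. \<forall>x\<in>carrier (rep_space \<rho>). (T \<circ> U) (rep_act \<rho> g x) = rep_act \<tau> g ((T \<circ> U) x)"
    by (simp add: Ua Ta unitary_opD(2)[OF U])
  then show ?thesis
    using assms unitary_op_comp[OF U T] unfolding unitarily_equivalent_def by blast
qed


section \<open>Permutation representations\<close>

text \<open>The inverse makes this a left action, which sends the point mass at \<open>x\<close> to
  the one at \<open>\<phi> g x\<close>; \<open>quasi_regular\<close> follows the same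
  convention.\<close>

definition perm_rep :: "('g, 'c) monoid_scheme \<Rightarrow> 'a set \<Rightarrow> ('g \<Rightarrow> 'a \<Rightarrow> 'a) \<Rightarrow>
    ('g, 'a \<Rightarrow> complex) rep" where
  "perm_rep G E \<phi> =
     \<lparr>rep_space = ell2 E, rep_act = (\<lambda>g f x. if x \<in> E then f (\<phi> (inv\<^bsub>G\<^esub> g) x) else 0)\<rparr>"

lemma perm_rep_simps [simp]:
  "rep_space (perm_rep G E \<phi>) = ell2 E"
  "rep_act (perm_rep G E \<phi>) g f = (\<lambda>x. if x \<in> E then f (\<phi> (inv\<^bsub>G\<^esub> g) x) else 0)"
  by (simp_all add: perm_rep_def)

text \<open>Bijectivity of \<open>\<phi> g\<close> follows from the pointwise axioms, with
  \<open>\<phi> (inv g)\<close> as inverse. Extensionality matches \<open>BijGroup\<close>, whose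
  elements are extensional and whose product is \<open>compose\<close>.\<close>

lemma group_actionI:
  fixes G (structure)
  assumes "group G" and ext: "\<And>g. g \<in> carrier G \<Longrightarrow> \<phi> g \<in> extensional E"
    and closed: "\<And>g x. \<lbrakk>g \<in> carrier G; x \<in> E\<rbrakk> \<Longrightarrow> \<phi> g x \<in> E"
    and one: "\<And>x. x \<in> E \<Longrightarrow> \<phi> \<one> x = x"
    and mult: "\<And>g h x. \<lbrakk>g \<in> carrier G; h \<in> carrier G; x \<in> E\<rbrakk> \<Longrightarrow> \<phi> (g \<otimes> h) x = \<phi> g (\<phi> h x)"
  shows "group_action G E \<phi>"
proof -
  interpret group G by fact
  have Bij: "\<phi> g \<in> Bij E" if g: "g \<in> carrier G" for g
  proof -
    have "\<phi> (inv g) (\<phi> g x) = x" "\<phi> g (\<phi> (inv g) x) = x" if "x \<in> E" for x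
      using that g mult[of "inv g" g x] mult[of g "inv g" x] one by simp_all
    then have "bij_betw (\<phi> g) E E"
      using g closed by (intro bij_betw_byWitness[of _ "\<phi> (inv g)"]) auto
    then show ?thesis using ext[OF g] by (simp add: Bij_def)
  qed
  have "\<phi> (g \<otimes> h) = compose E (\<phi> g) (\<phi> h)" if "g \<in> carrier G" "h \<in> carrier G" for g h
    using that ext[of "g \<otimes> h"] mult
    by (intro extensionalityI[of _ E]) (auto simp: compose_def)
  then have "\<phi> \<in> hom G (BijGroup E)"
    using Bij by (auto simp: hom_def BijGroup_def)
  then show ?thesis
    by (simp add: group_action_def group_hom_def group_hom_axioms_def group_BijGroup \<open>group G\<close>)
qed

lemma (in group) lcosets_l_coset_closed:
  assumes "subgroup H G" "g \<in> carrier G" "C \<in> lcosets H"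
  shows "g <# C \<in> lcosets H"
  using assms subgroup.subset[OF assms(1)]
  by (auto simp: LCOSETS_def lcos_m_assoc intro!: bexI[OF _ m_closed])

section \<open>Permutation unitaries and the orbit-stabilizer bijection\<close>

context group_action
begin

lemma group_G: "group G"
  using group_hom group_hom.axioms(1) by blast

lemma action_bij: "g \<in> carrier G \<Longrightarrow> bij_betw (\<phi> g) E E"
  using bij_prop0 by (auto simp: Bij_def)

lemma action_one: "x \<in> E \<Longrightarrow> \<phi> \<one> x = x"
  using id_eq_one by (metis restrict_apply')

lemma action_inv:
  assumes "g \<in> carrier G" "x \<in> E"
  shows "\<phi> (inv g) (\<phi> g x) = x" "\<phi> g (\<phi> (inv g) x) = x"
proof -
  interpret group G by (rule group_G)
  show "\<phi> (inv g) (\<phi> g x) = x" "\<phi> g (\<phi> (inv g) x) = x"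
    using assms composition_rule[of x "inv g" g] composition_rule[of x g "inv g"] action_one
    by simp_all
qed

lemma unitary_rep_perm_rep: "unitary_rep G (perm_rep G E \<phi>)"
proof -
  interpret group G by (rule group_G)
  define P where "P = rep_act (perm_rep G E \<phi>)"
  have P: "P g f = (\<lambda>x. if x \<in> E then f (\<phi> (inv g) x) else 0)" for g f
    by (simp add: P_def)
  have inE: "\<phi> g x \<in> E" if "g \<in> carrier G" "x \<in> E" for g x
    using that by (simp add: element_image)
  have closed: "P g f \<in> carrier (ell2 E)" if g: "g \<in> carrier G" and f: "f \<in> carrier (ell2 E)" for g f
  proof -
    have "(\<lambda>x. (cmod (f (\<phi> (inv g) x)))\<^sup>2) summable_on E"
      using f g summable_on_reindex_bij_betw[OF action_bij[of "inv g"], of "\<lambda>x. (cmod (f x))\<^sup>2"]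
      by (simp add: ell2_carrier)
    then show ?thesis by (simp add: ell2_carrier P cong: summable_on_cong)
  qed
  have mult: "P (g \<otimes> h) f = P g (P h f)" if "g \<in> carrier G" "h \<in> carrier G" for g h f
    using that by (auto simp: P fun_eq_iff inv_mult_group composition_rule inE)
  \<comment> \<open>Membership of \<open>f\<close> matters: \<open>P \<one>\<close> puts 0 at all
    points outside \<open>E\<close>, where \<open>f\<close> must already vanish.\<close>
  have one: "P \<one> f = f" if "f \<in> carrier (ell2 E)" for f
    using that by (auto simp: P fun_eq_iff ell2_carrier action_one)
  have "unitary_op (ell2 E) (ell2 E) (P g)" if g: "g \<in> carrier G" for g
  proof -
    have "P (inv g) (P g f) = f" "P g (P (inv g) f) = f" if "f \<in> carrier (ell2 E)" for f
      using that g by (simp_all add: one flip: mult)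
    then have "bij_betw (P g) (carrier (ell2 E)) (carrier (ell2 E))"
      using g closed by (intro bij_betw_byWitness[of _ "P (inv g)"]) auto
    moreover have "ip (ell2 E) (P g x) (P g y) = ip (ell2 E) x y" for x y
      using g infsum_reindex_bij_betw[OF action_bij[of "inv g"], of "\<lambda>e. x e * cnj (y e)"]
      by (simp add: P cong: infsum_cong)
    ultimately show ?thesis
      unfolding unitary_op_def by (auto simp: P fun_eq_iff simp del: ell2_simps(4))
  qed
  then show ?thesis
    using mult by (simp add: unitary_rep_def group_G hilbert_space_ell2 flip: P_def)
qed

text \<open>The orbit-stabilizer map, from cosets of the stabilizer of \<open>x\<close> to the
  orbit. A coset is a bare set, so a representative is chosen; the lemma of the same name shows that
  the choice is immaterial.\<close>

definition coset_point :: "'c \<Rightarrow> 'a set \<Rightarrow> 'c" where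
  "coset_point x C = \<phi> (SOME g. g \<in> C) x"

lemma coset_point:
  assumes x: "x \<in> E" and g: "g \<in> carrier G"
  shows "coset_point x (g <# stabilizer G \<phi> x) = \<phi> g x"
proof -
  interpret group G by (rule group_G)
  have S: "subgroup (stabilizer G \<phi> x) G" by (rule stabilizer_subgroup[OF x])
  define h where "h = (SOME h. h \<in> g <# stabilizer G \<phi> x)"
  have "h \<in> g <# stabilizer G \<phi> x"
    unfolding h_def by (rule someI[of _ g]) (rule lcos_self[OF g S])
  then obtain s where "s \<in> stabilizer G \<phi> x" "h = g \<otimes> s"
    by (auto simp: l_coset_def)
  then have "\<phi> h x = \<phi> g x"
    using composition_rule[OF x g, of s] by (simp add: stabilizer_def)
  then show ?thesis by (simp add: coset_point_def h_def)
qed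

lemma coset_point_bij:
  assumes x: "x \<in> E"
  shows "bij_betw (coset_point x) (lcosets (stabilizer G \<phi> x)) (orbit G \<phi> x)"
proof (rule bij_betw_imageI)
  interpret group G by (rule group_G)
  have S: "subgroup (stabilizer G \<phi> x) G" by (rule stabilizer_subgroup[OF x])
  show "inj_on (coset_point x) (lcosets (stabilizer G \<phi> x))"
  proof (rule inj_onI)
    fix C D assume "C \<in> lcosets (stabilizer G \<phi> x)" "D \<in> lcosets (stabilizer G \<phi> x)"
      and eq: "coset_point x C = coset_point x D"
    then obtain g h where g: "g \<in> carrier G" "C = g <# stabilizer G \<phi> x"
      and h: "h \<in> carrier G" "D = h <# stabilizer G \<phi> x"
      by (auto simp: LCOSETS_def)
    have "\<phi> g x = \<phi> h x" using eq g h coset_point[OF x] by simp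
    \<comment> \<open>Elements that move \<open>x\<close> to the same point differ by an element of
      the stabilizer, that is, they lie in one left coset.\<close>
    then have "inv h \<otimes> g \<in> stabilizer G \<phi> x"
      using g(1) h(1) x by (simp add: stabilizer_def composition_rule action_inv)
    then have "g \<in> h <# stabilizer G \<phi> x"
      using subgroup.lcos_module_rev[OF S group_G h(1) g(1)] by blast
    then show "C = D" using l_repr_independence[OF _ h(1) S] g(2) h(2) by simp
  qed
  show "coset_point x ` (lcosets (stabilizer G \<phi> x)) = orbit G \<phi> x"
    by (auto simp: LCOSETS_def orbit_def coset_point[OF x] image_UN)
qed

lemma coset_point_l_coset:
  assumes x: "x \<in> E" and g: "g \<in> carrier G" and C: "C \<in> lcosets (stabilizer G \<phi> x)"
  shows "coset_point x (g <# C) = \<phi> g (coset_point x C)"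
proof -
  interpret group G by (rule group_G)
  obtain h where "h \<in> carrier G" "C = h <# stabilizer G \<phi> x"
    using C by (auto simp: LCOSETS_def)
  then show ?thesis
    using g x stabilizer_subset by (simp add: lcos_m_assoc coset_point composition_rule)
qed

lemma orbit_subset: "x \<in> E \<Longrightarrow> orbit G \<phi> x \<subseteq> E"
  using element_image by (auto simp: orbit_def)

lemma orbit_eq:
  assumes x: "x \<in> E" and y: "y \<in> orbit G \<phi> x"
  shows "orbit G \<phi> y = orbit G \<phi> x"
proof -
  have yE: "y \<in> E" using orbit_subset[OF x] y by blast
  have "x \<in> orbit G \<phi> y" by (rule orbit_sym[OF x yE y])
  then show ?thesis
    using orbit_trans[OF x yE _ y] orbit_trans[OF yE x] orbit_subset[OF x] orbit_subset[OF yE]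
    by blast
qed

text \<open>Orbit by orbit, the orbit-stabilizer bijection identifies \<open>E\<close> with the disjoint union of the
  coset spaces, equivariantly.\<close>

theorem perm_rep_decomposition:
  assumes H: "\<And>\<mu>. \<mu> \<in> orbits G E \<phi> \<Longrightarrow> \<exists>x\<in>\<mu>. H \<mu> = stabilizer G \<phi> x"
  shows "unitarily_equivalent G (perm_rep G E \<phi>)
           (rep_sum (orbits G E \<phi>) (\<lambda>\<mu>. quasi_regular G (H \<mu>)))"
proof -
  interpret group G by (rule group_G)
  define I where "I = orbits G E \<phi>"
  have "\<forall>\<mu>\<in>I. \<exists>x. x \<in> \<mu> \<and> H \<mu> = stabilizer G \<phi> x" using H by (auto simp: I_def)
  \<comment> \<open>The base point must have stabilizer exactly \<open>H \<mu>\<close>; an arbitrary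
    point of the orbit would only give a conjugate.\<close>
  then obtain p where p: "\<And>\<mu>. \<mu> \<in> I \<Longrightarrow> p \<mu> \<in> \<mu>" "\<And>\<mu>. \<mu> \<in> I \<Longrightarrow> H \<mu> = stabilizer G \<phi> (p \<mu>)"
    by metis
  have orb: "p \<mu> \<in> E" "orbit G \<phi> (p \<mu>) = \<mu>" if \<mu>: "\<mu> \<in> I" for \<mu>
  proof -
    obtain y where y: "y \<in> E" "\<mu> = orbit G \<phi> y" using \<mu> by (auto simp: I_def orbits_def)
    then show "p \<mu> \<in> E" "orbit G \<phi> (p \<mu>) = \<mu>"
      using p(1)[OF \<mu>] orbit_subset[OF y(1)] orbit_eq[OF y(1), of "p \<mu>"] by auto
  qed
  define X where "X \<mu> = lcosets (H \<mu>)" for \<mu>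
  \<comment> \<open>The orbit-stabilizer bijections of all orbits, glued to one map on the disjoint
    union. It is injective across orbits because these are disjoint.\<close>
  define b where "b = (\<lambda>(\<mu>, C). coset_point (p \<mu>) C)"
  have bij: "bij_betw (coset_point (p \<mu>)) (X \<mu>) \<mu>" if "\<mu> \<in> I" for \<mu>
    using coset_point_bij[OF orb(1)[OF that]] by (simp add: X_def p(2)[OF that] orb(2)[OF that])
  have unique: "\<mu> = \<nu>" if "\<mu> \<in> I" "\<nu> \<in> I" "y \<in> \<mu>" "y \<in> \<nu>" for \<mu> \<nu> y
    using orbit_eq[OF orb(1)[OF that(1)], of y] orbit_eq[OF orb(1)[OF that(2)], of y]
      orb(2)[OF that(1)] orb(2)[OF that(2)] that(3,4) by simp
  have union: "\<Union>I = E"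
  proof
    show "\<Union>I \<subseteq> E" using orb orbit_subset by blast
    show "E \<subseteq> \<Union>I" using orbit_refl by (auto simp: I_def orbits_def)
  qed
  have "bij_betw b (Sigma I X) E"
  proof (rule bij_betw_imageI)
    show "inj_on b (Sigma I X)"
    proof (rule inj_onI)
      fix z z' assume "z \<in> Sigma I X" "z' \<in> Sigma I X" and eq: "b z = b z'"
      then obtain \<mu> C \<nu> D where z: "z = (\<mu>, C)" "\<mu> \<in> I" "C \<in> X \<mu>"
        and z': "z' = (\<nu>, D)" "\<nu> \<in> I" "D \<in> X \<nu>" by blast
      have "b z \<in> \<mu>" "b z' \<in> \<nu>"
        using z z' bij_betwE[OF bij] by (auto simp: b_def)
      then have "\<mu> = \<nu>" using unique z(2) z'(2) eq by metis
      then show "z = z'"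
        using eq z z' bij_betw_imp_inj_on[OF bij[OF z(2)]] by (auto simp: b_def inj_on_def)
    qed
    have "b ` Sigma I X = (\<Union>\<mu>\<in>I. coset_point (p \<mu>) ` X \<mu>)"
      by (force simp: b_def)
    also have "\<dots> = E" using bij by (simp add: bij_betw_def union)
    finally show "b ` Sigma I X = E" .
  qed
  note U = split_fun_unitary[OF this] and zero = split_fun_zero[of I X b E]
  let ?\<rho> = "rep_sum I (\<lambda>\<mu>. quasi_regular G (H \<mu>))"
  have space: "rep_space ?\<rho> = hilb_sum I (\<lambda>\<mu>. ell2 (X \<mu>))"
    by (simp add: rep_sum_def quasi_regular_def X_def)
  have "rep_act ?\<rho> g (split_fun I X b f) = split_fun I X b (rep_act (perm_rep G E \<phi>) g f)"
    if g: "g \<in> carrier G" for g f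
  proof -
    \<comment> \<open>At a coset \<open>C\<close> in \<open>X \<mu>\<close> both sides are the value
      of \<open>f\<close> at \<open>\<phi> (inv g) (b (\<mu>, C))\<close>, by equivariance of
      \<open>coset_point\<close>; elsewhere both are 0.\<close>
    have "rep_act (quasi_regular G (H \<mu>)) g (split_fun I X b f \<mu>) C =
        split_fun I X b (rep_act (perm_rep G E \<phi>) g f) \<mu> C" if \<mu>: "\<mu> \<in> I" for \<mu> C
    proof (cases "C \<in> X \<mu>")
      case True
      then have C: "C \<in> lcosets (stabilizer G \<phi> (p \<mu>))" by (simp add: X_def p(2)[OF \<mu>])
      have "inv g <# C \<in> X \<mu>"
        using lcosets_l_coset_closed[OF stabilizer_subgroup[OF orb(1)[OF \<mu>]] _ C, of "inv g"] g
        by (simp add: X_def p(2)[OF \<mu>])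
      moreover have "b (\<mu>, inv g <# C) = \<phi> (inv g) (b (\<mu>, C))"
        using coset_point_l_coset[OF orb(1)[OF \<mu>] _ C, of "inv g"] g by (simp add: b_def)
      moreover have "b (\<mu>, C) \<in> E"
        using bij_betwE[OF bij[OF \<mu>]] True union \<mu> by (auto simp: b_def)
      ultimately show ?thesis
        using True \<mu> by (simp add: quasi_regular_def split_fun_def flip: X_def)
    next
      case False
      then show ?thesis using \<mu> by (simp add: quasi_regular_def split_fun_def flip: X_def)
    qed
    then have act: "rep_act (quasi_regular G (H \<mu>)) g (split_fun I X b f \<mu>) =
        split_fun I X b (rep_act (perm_rep G E \<phi>) g f) \<mu>" if "\<mu> \<in> I" for \<mu>
      using that by blast
    show ?thesis
    proof
      fix \<mu>
      show "rep_act ?\<rho> g (split_fun I X b f) \<mu> =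
          split_fun I X b (rep_act (perm_rep G E \<phi>) g f) \<mu>"
      proof (cases "\<mu> \<in> I")
        case True
        then show ?thesis using act by (simp add: rep_sum_def)
      next
        case False
        then show ?thesis by (simp add: rep_sum_def split_fun_def)
      qed
    qed
  qed
  then show ?thesis
    unfolding I_def[symmetric]
    using U zero by (intro unitary_rep_transport[OF unitary_rep_perm_rep, where U = "split_fun I X b"])
      (simp_all add: space)
qed

end


section \<open>The tensor product of two quasi-regular representations\<close>

text \<open>The action treats the coordinates separately, so the homomorphism rules for products and
  inverses are wanted for each of them.\<close>

lemma phi_components:
  assumes "n \<ge> 1" "m \<ge> 1"
  shows "(\<lambda>g. fst (phi n m g)) \<in> hom (free_group (n * m)) (free_group n)"
    and "(\<lambda>g. snd (phi n m g)) \<in> hom (free_group (n * m)) (free_group m)"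
proof -
  have "fst \<in> hom (free_group n \<times>\<times> free_group m) (free_group n)"
    "snd \<in> hom (free_group n \<times>\<times> free_group m) (free_group m)"
    by (auto simp: hom_def)
  then show "(\<lambda>g. fst (phi n m g)) \<in> hom (free_group (n * m)) (free_group n)"
    "(\<lambda>g. snd (phi n m g)) \<in> hom (free_group (n * m)) (free_group m)"
    using hom_compose[OF phi_hom(1)[OF assms]] by (auto simp: comp_def)
qed

theorem group_action_phi_action:
  assumes nm: "n \<ge> 1" "m \<ge> 1"
    and H': "subgroup H' (free_group n)" and H'': "subgroup H'' (free_group m)"
  shows "group_action (free_group (n * m)) (coset_pairs n m H' H'') (phi_action n m H' H'')"
proof -
  let ?E = "coset_pairs n m H' H''" and ?N = "free_group n" and ?M = "free_group m"
  interpret N: group ?N by (rule group_free_group)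
  interpret M: group ?M by (rule group_free_group)
  interpret p: group_hom "free_group (n * m)" ?N "\<lambda>g. fst (phi n m g)"
    using phi_components(1)[OF nm] by (simp add: group_hom_def group_hom_axioms_def group_free_group)
  interpret q: group_hom "free_group (n * m)" ?M "\<lambda>g. snd (phi n m g)"
    using phi_components(2)[OF nm] by (simp add: group_hom_def group_hom_axioms_def group_free_group)
  note closed = N.lcosets_l_coset_closed[OF H'] M.lcosets_l_coset_closed[OF H'']
  note sub = subgroup.lcosets_carrier[OF H' N.is_group] subgroup.lcosets_carrier[OF H'' M.is_group]
  show ?thesis
  proof (rule group_actionI[OF group_free_group])
    fix g assume "g \<in> carrier (free_group (n * m))"
    then show "phi_action n m H' H'' g \<in> extensional ?E" by (simp add: phi_action_def)
  next
    fix g x assume "g \<in> carrier (free_group (n * m))" "x \<in> ?E"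
    then show "phi_action n m H' H'' g x \<in> ?E"
      by (auto simp: phi_action_def coset_pairs_def closed)
  next
    fix x assume "x \<in> ?E"
    then show "phi_action n m H' H'' \<one>\<^bsub>free_group (n * m)\<^esub> x = x"
      using sub by (auto simp: phi_action_def coset_pairs_def N.lcos_mult_one M.lcos_mult_one)
  next
    fix g h x assume "g \<in> carrier (free_group (n * m))" "h \<in> carrier (free_group (n * m))" "x \<in> ?E"
    then show "phi_action n m H' H'' (g \<otimes>\<^bsub>free_group (n * m)\<^esub> h) x
        = phi_action n m H' H'' g (phi_action n m H' H'' h x)"
      using sub by (auto simp: phi_action_def coset_pairs_def closed N.lcos_m_assoc M.lcos_m_assoc)
  qed
qed

text \<open>Translation by the inverse of \<open>g\<close> permutes the cosets. This supplies the
  closure hypotheses of \<open>free_tensor_op_closed\<close> for both tensor factors.\<close>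

lemma quasi_regular_closed:
  assumes G: "group G" and H: "subgroup H G" and g: "g \<in> carrier G"
    and f: "f \<in> carrier (ell2 (lcosets\<^bsub>G\<^esub> H))"
  shows "rep_act (quasi_regular G H) g f \<in> carrier (ell2 (lcosets\<^bsub>G\<^esub> H))"
proof -
  interpret group G by fact
  let ?X = "lcosets\<^bsub>G\<^esub> H"
  have sub: "C \<subseteq> carrier G" if "C \<in> ?X" for C
    using subgroup.lcosets_carrier[OF H G that] .
  have "bij_betw (\<lambda>C. inv\<^bsub>G\<^esub> g <#\<^bsub>G\<^esub> C) ?X ?X"
    using g lcosets_l_coset_closed[OF H] sub
    by (intro bij_betw_byWitness[of _ "\<lambda>C. g <#\<^bsub>G\<^esub> C"]) (auto simp: lcos_m_assoc lcos_mult_one)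
  then have "(\<lambda>C. (cmod (f (inv\<^bsub>G\<^esub> g <#\<^bsub>G\<^esub> C)))\<^sup>2) summable_on ?X"
    using f summable_on_reindex_bij_betw[of _ ?X ?X "\<lambda>C. (cmod (f C))\<^sup>2"] by (simp add: ell2_carrier)
  then show ?thesis
    by (simp add: ell2_carrier quasi_regular_def cong: summable_on_cong)
qed

text \<open>By linearity, \<open>tensor_fun\<close> intertwines the operators as soon as it does so
  on elementary tensors; \<open>fiber_map\<close> then extends the relation from formal sums to the
  completion.\<close>

theorem perm_rep_tensor:
  assumes nm: "n \<ge> 1" "m \<ge> 1"
    and H': "subgroup H' (free_group n)" and H'': "subgroup H'' (free_group m)"
  shows "unitarily_equivalent (free_group (n * m))
    (perm_rep (free_group (n * m)) (coset_pairs n m H' H'') (phi_action n m H' H''))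
    (tensor_phi n m (quasi_regular (free_group n) H') (quasi_regular (free_group m) H''))"
proof -
  let ?G = "free_group (n * m)" and ?N = "free_group n" and ?M = "free_group m"
  let ?X = "lcosets\<^bsub>?N\<^esub> H'" and ?Y = "lcosets\<^bsub>?M\<^esub> H''"
  let ?\<pi> = "perm_rep ?G (coset_pairs n m H' H'') (phi_action n m H' H'')"
  let ?A = "rep_act (quasi_regular ?N H')" and ?B = "rep_act (quasi_regular ?M H'')"
  let ?F = "free_tensor (ell2 ?X) (ell2 ?Y)"
  interpret action: group_action ?G "coset_pairs n m H' H''" "phi_action n m H' H''"
    by (rule group_action_phi_action[OF assms])
  interpret G: group ?G by (rule group_free_group)
  interpret p: group_hom ?G ?N "\<lambda>g. fst (phi n m g)"
    using phi_components(1)[OF nm] by (simp add: group_hom_def group_hom_axioms_def group_free_group)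
  interpret q: group_hom ?G ?M "\<lambda>g. snd (phi n m g)"
    using phi_components(2)[OF nm] by (simp add: group_hom_def group_hom_axioms_def group_free_group)
  have space: "rep_space ?\<pi> = ell2 (?X \<times> ?Y)" by (simp add: coset_pairs_def)
  have space': "rep_space (tensor_phi n m (quasi_regular ?N H') (quasi_regular ?M H'')) = completion ?F"
    by (simp add: tensor_phi_def rep_tensor_def hilb_tensor_def quasi_regular_def)
  have act: "tensor_op (ell2 ?X) (ell2 ?Y) (?A (fst (phi n m g))) (?B (snd (phi n m g))) (tensor.fiber ?X ?Y w)
      = tensor.fiber ?X ?Y (rep_act ?\<pi> g w)"
    if g: "g \<in> carrier ?G" and w: "w \<in> carrier (ell2 (?X \<times> ?Y))" for g w
  proof -
    let ?T = "free_tensor_op (?A (fst (phi n m g))) (?B (snd (phi n m g)))"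
    have "unitary_op (ell2 (?X \<times> ?Y)) (ell2 (?X \<times> ?Y)) (rep_act ?\<pi> g)"
      using action.unitary_rep_perm_rep g unfolding unitary_rep_def space by blast
    moreover have "?T s \<in> carrier ?F" if "s \<in> carrier ?F" for s
      using that g by (intro free_tensor_op_closed quasi_regular_closed group_free_group H' H'')
        (simp_all del: free_tensor_simps(1))
    moreover have "tensor_fun (?T s) = rep_act ?\<pi> g (tensor_fun s)" if "s \<in> carrier ?F" for s
    proof
      fix z
      \<comment> \<open>As \<open>phi\<close> respects inverses, both sides evaluate the factors at
        the translated cosets. If \<open>z\<close> is not a pair of cosets, a factor on the left is
        0, and so is the right side.\<close>
      have el: "elem_tensor (map_prod (?A (fst (phi n m g))) (?B (snd (phi n m g))) a) z =
          rep_act ?\<pi> g (elem_tensor a) z" for a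
        using g by (cases a; cases z)
          (simp add: elem_tensor_def quasi_regular_def coset_pairs_def phi_action_def)
      show "tensor_fun (?T s) z = rep_act ?\<pi> g (tensor_fun s) z"
        unfolding tensor_fun_op el by (simp add: tensor_fun_def)
    qed
    ultimately show ?thesis
      unfolding tensor_op_def using tensor.fiber_map[where T = ?T] w by blast
  qed
  show ?thesis
  proof (rule unitary_rep_transport[OF action.unitary_rep_perm_rep, where U = "tensor.fiber ?X ?Y"],
      unfold space space')
    fix g w assume "g \<in> carrier ?G" "w \<in> carrier (ell2 (?X \<times> ?Y))"
    from act[OF this]
    show "rep_act (tensor_phi n m (quasi_regular ?N H') (quasi_regular ?M H'')) g (tensor.fiber ?X ?Y w)
        = tensor.fiber ?X ?Y (rep_act ?\<pi> g w)"
      by (simp add: tensor_phi_def rep_tensor_def case_prod_beta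
          quasi_regular_def[THEN arg_cong[where f = rep_space]] del: perm_rep_simps(2))
  qed (rule tensor.completion_unitary tensor.completion_zero)+
qed

theorem theorem3p2:
  fixes n m :: nat and H' H'' :: "word set"
    and H :: "(word set \<times> word set) set \<Rightarrow> word set"
  assumes "n \<ge> 1" and "m \<ge> 1"
    and "subgroup H' (free_group n)" and "subgroup H'' (free_group m)"
    and "\<And>\<mu>. \<mu> \<in> orbits (free_group (n * m)) (coset_pairs n m H' H'') (phi_action n m H' H'') \<Longrightarrow>
           \<exists>x\<in>\<mu>. H \<mu> = stabilizer (free_group (n * m)) (phi_action n m H' H'') x"
  shows "unitarily_equivalent (free_group (n * m))
           (tensor_phi n m (quasi_regular (free_group n) H') (quasi_regular (free_group m) H''))
           (rep_sum (orbits (free_group (n * m)) (coset_pairs n m H' H'') (phi_action n m H' H''))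
              (\<lambda>\<mu>. quasi_regular (free_group (n * m)) (H \<mu>)))"
proof -
  interpret group_action "free_group (n * m)" "coset_pairs n m H' H''" "phi_action n m H' H''"
    by (rule group_action_phi_action[OF assms(1-4)])
  \<comment> \<open>Both unitaries start at the permutation representation, so the one to the tensor
    product is inverted before they are composed.\<close>
  show ?thesis
    using unitarily_equivalent_trans[OF
        unitarily_equivalent_sym[OF perm_rep_tensor[OF assms(1-4)]]
        perm_rep_decomposition[OF assms(5)]] .
qed

end
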